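(* Let $0<r_0<r_1$, and let the background flow, the coefficients $\bar A_{ij},e_1,e_2$, the functions $l_1,l_2$ on $[\theta_-,\theta_+]$ and the constant $\sigma_0>0$ be as in the context. Let $\Omega_1=(r_0,r_1)\times(\theta_{so}-\sigma_0,\theta_+)$. For any smooth solution $\Psi$ to the boundary value problem $$\begin{cases}\bar A_{11}(\theta)\partial_r^2\Psi+\frac{2\bar A_{12}(\theta)}{r}\partial_{r\theta}^2\Psi+\frac{\bar A_{22}(\theta)}{r^2}\partial_\theta^2\Psi+\frac{e_1(\theta)}{r}\partial_r\Psi+\frac{e_2(\theta)}{r^2}\partial_\theta\Psi=F(r,\theta)\quad\text{in }\Omega_1,\\ \frac1{r_0}\partial_\theta\Psi(r_0,\theta)=g_0(\theta),\\ \partial_r\Psi(r_1,\theta)+\frac{l_2(\theta)}{l_1(\theta)}\frac1{r_1}\partial_\theta\Psi(r_1,\theta)=g_1(\theta),\\ \partial_r\Psi(r,\theta_{so}-\sigma_0)+\frac{l_2(\theta_{so}-\sigma_0)}{l_1(\theta_{so}-\sigma_0)}\frac1r\partial_\theta\Psi(r,\theta_{so}-\sigma_0)=h_0(r),\\ \partial_r\Psi(r,\theta_+)=h_1(r),\end{cases}$$ the following energy estimate holds: $$\begin{aligned}&\iint_{\Omega_1}r^2\Big[(\partial_r\Psi)^2+\big(\tfrac1r\partial_\theta\Psi\big)^2\Big]drd\theta+\int_{\theta_{so}-\sigma_0}^{\theta_+}\Big[r_0^3\big(\partial_r\Psi+\tfrac{l_2}{l_1}\tfrac1{r_0}\partial_\theta\Psi\big)^2(r_0,\theta)+r_1(\partial_\theta\Psi)^2(r_1,\theta)\Big]d\theta\\&\quad+\int_{r_0}^{r_1}\Big[r^2\big(\partial_r\Psi+\tfrac{l_2}{l_1}\tfrac1r\partial_\theta\Psi\big)^2(r,\theta_+)+r^2(\partial_r\Psi)^2(r,\theta_{so}-\sigma_0)\Big]dr\\&\le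 C_*\Big(\iint_{\Omega_1}r^4F^2\,drd\theta+\int_{\theta_{so}-\sigma_0}^{\theta_+}\big[r_1^3g_1^2(\theta)+r_0^3g_0^2(\theta)\big]d\theta+\int_{r_0}^{r_1}r^2\big(h_0^2(r)+h_1^2(r)\big)dr\Big),\end{aligned}$$ where $C_*$ is a positive constant that depends solely on the background solution, $\theta_{so}-\sigma_0$ and $\theta_+$, but not on $r_0$ and $r_1$. Moreover, the smooth solution to this boundary value problem is unique.
   Context: Background flow: fix $\gamma>1$, $A_0,B_0>0$, $\theta_{so}\in(0,\frac\pi2)$, $U_{01},U_{02}>0$ with $U_{01}^2+U_{02}^2=\frac{2(\gamma-1)}{\gamma+1}B_0$. On an interval $[\theta_-,\theta_+]$ with $0<\theta_-<\theta_{so}<\theta_+<\frac\pi2$, $(\bar U_1,\bar U_2)$ is the smooth solution of $$\bar U_1'=\bar U_2,\quad \bar U_2'=-\bar U_1-\frac{\bar U_1\sin\theta+\bar U_2\cos\theta}{(1-\bar M_2^2)\sin\theta},\quad c^2(\bar\rho)=A_0\gamma\bar\rho^{\gamma-1}=(\gamma-1)\big(B_0-\tfrac12(\bar U_1^2+\bar U_2^2)\big),$$ with $(\bar U_1,\bar U_2)(\theta_{so})=(U_{01},U_{02})$, where $\bar M_i=\bar U_i/c(\bar\rho)$; the interval is such that on it $\bar U_1,\bar U_2>0$, $1-\bar M_1^2>0$, $1-\bar M_2^2>0$, and $|\bar{\mathbf M}|^2=\bar M_1^2+\bar M_2^2$ is strictly decreasing with $|\bar{\mathbf M}(\theta_{so})|^2=1$.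 Coefficients (functions of $\theta$): $\bar A_{11}=c^2(\bar\rho)-\bar U_1^2$, $\bar A_{12}=-\bar U_1\bar U_2$, $\bar A_{22}=c^2(\bar\rho)-\bar U_2^2$, $$e_1=2c^2(\bar\rho)-\bar U_2^2+\frac{(\gamma-1)\bar U_1\bar M_2^2(\bar U_1\sin\theta+\bar U_2\cos\theta)}{(1-\bar M_2^2)\sin\theta},$$ $$e_2=(3-\gamma)\bar U_2(\bar U_1+\bar U_2\cot\theta)+\frac{(\gamma+1)\bar U_2}{1-\bar M_2^2}(\bar U_1+\bar U_2\cot\theta)+(c^2(\bar\rho)-2\bar U_2^2)\cot\theta,$$ $\bar k_{11}=\frac{1-\bar M_1^2-\bar M_2^2}{(1-\bar M_2^2)^2}$, $\bar k_2=e_2/\bar A_{22}$, $f(\theta)=\exp\int_{\theta_c}^\theta\frac{\bar A_{12}}{\bar A_{22}}d\tau$ for a fixed reference angle $\theta_c\in[\theta_-,\theta_+]$. Functions $l_1,l_2$: fix $d_1(\theta_{so})>0$, put $d_1(\theta)=d_1(\theta_{so})e^{\int_{\theta_{so}}^\theta\bar k_2d\tau}$, $d_*=\max\{\|d_1\|_{L^\infty},4\}$, and $$d_2(\theta)=d_2(\theta_{so})e^{2\int_{\theta_{so}}^{\theta}\bar k_2d\tau}-2d_*\int_{\theta_{so}}^\theta e^{2\int_s^\theta\bar k_2d\tau}ds,$$ with the constant $d_2(\theta_{so})>0$ fixed so large that on $[\theta_-,\theta_+]$: $d_2>0$ and $\frac12[(\bar k_{11}d_2)'-\bar k_{11}d_1]\ge2$.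 Then $$l_1=\frac1{f\bar A_{22}}\Big(\frac{f'}{f}d_2-d_1\Big)<0,\qquad l_2=\frac{d_2}{f\bar A_{22}}>0.$$ The constant $\sigma_0>0$ (with $\theta_{so}-\sigma_0\ge\theta_-$) is small enough that $K_4:=2\bar A_{12}l_2-\frac{\bar A_{11}l_2^2}{l_1}-\bar A_{22}l_1>0$ on $[\theta_{so}-\sigma_0,\theta_+]$.
   Formalization: Uniqueness of the smooth solution is stated and proved up to an additive constant, since the equation and all boundary conditions involve only derivatives of Ψ, so Ψ + c is a solution with the same data. *)

theory Defs
  imports "HOL-Analysis.Analysis"
begin

text \<open>
  Derivatives are taken within the (closed) domain, so that they are one-sided at the boundary and
  no values outside the domain matter. All sets used below are nondegenerate compact intervals or
  rectangles, on which the Frechet derivative within the set is unique.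
\<close>

definition pd :: "'a::euclidean_space set \<Rightarrow> 'a \<Rightarrow> ('a \<Rightarrow> real) \<Rightarrow> 'a \<Rightarrow> real" where
  "pd S v f z = frechet_derivative f (at z within S) v"

primrec Ck_on :: "nat \<Rightarrow> 'a::euclidean_space set \<Rightarrow> ('a \<Rightarrow> real) \<Rightarrow> bool" where
  "Ck_on 0 S f \<longleftrightarrow> continuous_on S f"
| "Ck_on (Suc k) S f \<longleftrightarrow> f differentiable_on S \<and> (\<forall>v\<in>Basis. Ck_on k S (pd S v f))"

definition smooth_upto :: "'a::euclidean_space set \<Rightarrow> ('a \<Rightarrow> real) \<Rightarrow> bool" where
  "smooth_upto S f \<longleftrightarrow> (\<forall>k. Ck_on k S f)"

record flow =
  gam :: real
  A0 :: real
  B0 :: real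
  th_so :: real
  U01 :: real
  U02 :: real
  th_m :: real
  th_p :: real
  U1 :: "real \<Rightarrow> real"
  U2 :: "real \<Rightarrow> real"
  rho :: "real \<Rightarrow> real"

abbreviation ang :: "flow \<Rightarrow> real set" where
  "ang b \<equiv> {th_m b..th_p b}"

definition c2 :: "flow \<Rightarrow> real \<Rightarrow> real" where
  "c2 b \<theta> = A0 b * gam b * rho b \<theta> powr (gam b - 1)"

definition M1 :: "flow \<Rightarrow> real \<Rightarrow> real" where
  "M1 b \<theta> = U1 b \<theta> / sqrt (c2 b \<theta>)"

definition M2 :: "flow \<Rightarrow> real \<Rightarrow> real" where
  "M2 b \<theta> = U2 b \<theta> / sqrt (c2 b \<theta>)"

definition background_flow :: "flow \<Rightarrow> bool" where
  "background_flow b \<longleftrightarrow>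
     gam b > 1 \<and> A0 b > 0 \<and> B0 b > 0 \<and>
     0 < th_so b \<and> th_so b < pi / 2 \<and>
     U01 b > 0 \<and> U02 b > 0 \<and>
     (U01 b)\<^sup>2 + (U02 b)\<^sup>2 = 2 * (gam b - 1) / (gam b + 1) * B0 b \<and>
     0 < th_m b \<and> th_m b < th_so b \<and> th_so b < th_p b \<and> th_p b < pi / 2 \<and>
     smooth_upto (ang b) (U1 b) \<and> smooth_upto (ang b) (U2 b) \<and>
     U1 b (th_so b) = U01 b \<and> U2 b (th_so b) = U02 b \<and>
     (\<forall>\<theta>\<in>ang b.
        (U1 b has_real_derivative U2 b \<theta>) (at \<theta> within ang b) \<and>
        (U2 b has_real_derivative
           - U1 b \<theta> - (U1 b \<theta> * sin \<theta> + U2 b \<theta> * cos \<theta>) / ((1 - (M2 b \<theta>)\<^sup>2) * sin \<theta>))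
           (at \<theta> within ang b) \<and>
        rho b \<theta> > 0 \<and>
        c2 b \<theta> = (gam b - 1) * (B0 b - 1/2 * ((U1 b \<theta>)\<^sup>2 + (U2 b \<theta>)\<^sup>2)) \<and>
        U1 b \<theta> > 0 \<and> U2 b \<theta> > 0 \<and>
        1 - (M1 b \<theta>)\<^sup>2 > 0 \<and> 1 - (M2 b \<theta>)\<^sup>2 > 0) \<and>
     strict_antimono_on (ang b) (\<lambda>\<theta>. (M1 b \<theta>)\<^sup>2 + (M2 b \<theta>)\<^sup>2) \<and>
     (M1 b (th_so b))\<^sup>2 + (M2 b (th_so b))\<^sup>2 = 1"

definition A11 :: "flow \<Rightarrow> real \<Rightarrow> real" where
  "A11 b \<theta> = c2 b \<theta> - (U1 b \<theta>)\<^sup>2"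

definition A12 :: "flow \<Rightarrow> real \<Rightarrow> real" where
  "A12 b \<theta> = - U1 b \<theta> * U2 b \<theta>"

definition A22 :: "flow \<Rightarrow> real \<Rightarrow> real" where
  "A22 b \<theta> = c2 b \<theta> - (U2 b \<theta>)\<^sup>2"

definition e1 :: "flow \<Rightarrow> real \<Rightarrow> real" where
  "e1 b \<theta> = 2 * c2 b \<theta> - (U2 b \<theta>)\<^sup>2
     + (gam b - 1) * U1 b \<theta> * (M2 b \<theta>)\<^sup>2 * (U1 b \<theta> * sin \<theta> + U2 b \<theta> * cos \<theta>)
       / ((1 - (M2 b \<theta>)\<^sup>2) * sin \<theta>)"

definition e2 :: "flow \<Rightarrow> real \<Rightarrow> real" where
  "e2 b \<theta> = (3 - gam b) * U2 b \<theta> * (U1 b \<theta> + U2 b \<theta> * cot \<theta>)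
     + (gam b + 1) * U2 b \<theta> / (1 - (M2 b \<theta>)\<^sup>2) * (U1 b \<theta> + U2 b \<theta> * cot \<theta>)
     + (c2 b \<theta> - 2 * (U2 b \<theta>)\<^sup>2) * cot \<theta>"

definition k11 :: "flow \<Rightarrow> real \<Rightarrow> real" where
  "k11 b \<theta> = (1 - (M1 b \<theta>)\<^sup>2 - (M2 b \<theta>)\<^sup>2) / (1 - (M2 b \<theta>)\<^sup>2)\<^sup>2"

definition k2 :: "flow \<Rightarrow> real \<Rightarrow> real" where
  "k2 b \<theta> = e2 b \<theta> / A22 b \<theta>"

text \<open>
  The interval integral is oriented, so the formulas below also hold for \<open>\<theta>\<close> to the left of the
  base point. The arguments \<open>thc\<close>, \<open>\<delta>1\<close>, \<open>\<delta>2\<close> are the reference angle \<open>\<theta>\<^sub>c\<close> and the values of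
  \<open>d\<^sub>1\<close>, \<open>d\<^sub>2\<close> at \<open>\<theta>\<^sub>s\<^sub>o\<close>.
\<close>

definition fexp :: "flow \<Rightarrow> real \<Rightarrow> real \<Rightarrow> real" where
  "fexp b thc \<theta> = exp (LBINT \<tau>=thc..\<theta>. A12 b \<tau> / A22 b \<tau>)"

definition d1 :: "flow \<Rightarrow> real \<Rightarrow> real \<Rightarrow> real" where
  "d1 b \<delta>1 \<theta> = \<delta>1 * exp (LBINT \<tau>=th_so b..\<theta>. k2 b \<tau>)"

text \<open>For the continuous function \<open>d\<^sub>1\<close> the essential supremum norm is the supremum.\<close>

definition dstar :: "flow \<Rightarrow> real \<Rightarrow> real" where
  "dstar b \<delta>1 = max (SUP \<theta>\<in>ang b. \<bar>d1 b \<delta>1 \<theta>\<bar>) 4"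

definition d2 :: "flow \<Rightarrow> real \<Rightarrow> real \<Rightarrow> real \<Rightarrow> real" where
  "d2 b \<delta>1 \<delta>2 \<theta> =
     \<delta>2 * exp (2 * (LBINT \<tau>=th_so b..\<theta>. k2 b \<tau>))
     - 2 * dstar b \<delta>1 * (LBINT s=th_so b..\<theta>. exp (2 * (LBINT \<tau>=s..\<theta>. k2 b \<tau>)))"

definition d_admissible :: "flow \<Rightarrow> real \<Rightarrow> real \<Rightarrow> bool" where
  "d_admissible b \<delta>1 \<delta>2 \<longleftrightarrow> \<delta>1 > 0 \<and> \<delta>2 > 0 \<and>
     (\<forall>\<theta>\<in>ang b. d2 b \<delta>1 \<delta>2 \<theta> > 0 \<and>
        1/2 * (vector_derivative (\<lambda>t. k11 b t * d2 b \<delta>1 \<delta>2 t) (at \<theta> within ang b)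
               - k11 b \<theta> * d1 b \<delta>1 \<theta>) \<ge> 2)"

definition l1 :: "flow \<Rightarrow> real \<Rightarrow> real \<Rightarrow> real \<Rightarrow> real \<Rightarrow> real" where
  "l1 b thc \<delta>1 \<delta>2 \<theta> =
     1 / (fexp b thc \<theta> * A22 b \<theta>)
     * (vector_derivative (fexp b thc) (at \<theta> within ang b) / fexp b thc \<theta> * d2 b \<delta>1 \<delta>2 \<theta> - d1 b \<delta>1 \<theta>)"

definition l2 :: "flow \<Rightarrow> real \<Rightarrow> real \<Rightarrow> real \<Rightarrow> real \<Rightarrow> real" where
  "l2 b thc \<delta>1 \<delta>2 \<theta> = d2 b \<delta>1 \<delta>2 \<theta> / (fexp b thc \<theta> * A22 b \<theta>)"

definition K4 :: "flow \<Rightarrow> real \<Rightarrow> real \<Rightarrow> real \<Rightarrow> real \<Rightarrow> real" where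
  "K4 b thc \<delta>1 \<delta>2 \<theta> =
     2 * A12 b \<theta> * l2 b thc \<delta>1 \<delta>2 \<theta>
     - A11 b \<theta> * (l2 b thc \<delta>1 \<delta>2 \<theta>)\<^sup>2 / l1 b thc \<delta>1 \<delta>2 \<theta>
     - A22 b \<theta> * l1 b thc \<delta>1 \<delta>2 \<theta>"

definition obl :: "flow \<Rightarrow> real \<Rightarrow> real \<Rightarrow> real \<Rightarrow> real \<Rightarrow> real" where
  "obl b thc \<delta>1 \<delta>2 \<theta> = l2 b thc \<delta>1 \<delta>2 \<theta> / l1 b thc \<delta>1 \<delta>2 \<theta>"

text \<open>
  A smooth solution is a function that is smooth up to the boundary of the rectangle
  \<open>(r0, r1) \<times> (th0, th1)\<close>. The argument \<open>m\<close> is used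
  with \<open>l\<^sub>2 / l\<^sub>1\<close>. The boundary conditions are imposed on the open sides; by continuity they
  determine the traces at the corners. Only derivatives of \<open>\<Psi>\<close> occur, so adding a constant to a
  solution gives a solution with the same data: uniqueness can only hold up to an additive constant.
\<close>

definition bvp_solution ::
  "flow \<Rightarrow> (real \<Rightarrow> real) \<Rightarrow> real \<Rightarrow> real \<Rightarrow> real \<Rightarrow> real \<Rightarrow>
   (real \<Rightarrow> real \<Rightarrow> real) \<Rightarrow> (real \<Rightarrow> real) \<Rightarrow> (real \<Rightarrow> real) \<Rightarrow> (real \<Rightarrow> real) \<Rightarrow> (real \<Rightarrow> real) \<Rightarrow>
   (real \<times> real \<Rightarrow> real) \<Rightarrow> bool" where
  "bvp_solution b m th0 th1 r0 r1 F g0 g1 h0 h1 \<Psi> \<longleftrightarrow>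
     (let S = {r0..r1} \<times> {th0..th1};
          Dr = pd S (1, 0);
          Dth = pd S (0, 1)
      in smooth_upto S \<Psi> \<and>
         (\<forall>r\<in>{r0<..<r1}. \<forall>\<theta>\<in>{th0<..<th1}.
            A11 b \<theta> * Dr (Dr \<Psi>) (r, \<theta>)
            + 2 * A12 b \<theta> / r * Dr (Dth \<Psi>) (r, \<theta>)
            + A22 b \<theta> / r\<^sup>2 * Dth (Dth \<Psi>) (r, \<theta>)
            + e1 b \<theta> / r * Dr \<Psi> (r, \<theta>)
            + e2 b \<theta> / r\<^sup>2 * Dth \<Psi> (r, \<theta>) = F r \<theta>) \<and>
         (\<forall>\<theta>\<in>{th0<..<th1}. 1 / r0 * Dth \<Psi> (r0, \<theta>) = g0 \<theta>) \<and>
         (\<forall>\<theta>\<in>{th0<..<th1}. Dr \<Psi> (r1, \<theta>) + m \<theta> * (1 / r1) * Dth \<Psi> (r1, \<theta>) = g1 \<theta>) \<and>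
         (\<forall>r\<in>{r0<..<r1}. Dr \<Psi> (r, th0) + m th0 * (1 / r) * Dth \<Psi> (r, th0) = h0 r) \<and>
         (\<forall>r\<in>{r0<..<r1}. Dr \<Psi> (r, th1) = h1 r))"

definition energy ::
  "(real \<Rightarrow> real) \<Rightarrow> real \<Rightarrow> real \<Rightarrow> real \<Rightarrow> real \<Rightarrow> (real \<times> real \<Rightarrow> real) \<Rightarrow> real" where
  "energy m th0 th1 r0 r1 \<Psi> =
     (let S = {r0..r1} \<times> {th0..th1};
          \<Psi>r = pd S (1, 0) \<Psi>;
          \<Psi>\<theta> = pd S (0, 1) \<Psi>
      in integral ({r0<..<r1} \<times> {th0<..<th1})
           (\<lambda>(r, \<theta>). r\<^sup>2 * ((\<Psi>r (r, \<theta>))\<^sup>2 + (1 / r * \<Psi>\<theta> (r, \<theta>))\<^sup>2))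
         + integral {th0..th1}
             (\<lambda>\<theta>. r0 ^ 3 * (\<Psi>r (r0, \<theta>) + m \<theta> * (1 / r0) * \<Psi>\<theta> (r0, \<theta>))\<^sup>2
                   + r1 * (\<Psi>\<theta> (r1, \<theta>))\<^sup>2)
         + integral {r0..r1}
             (\<lambda>r. r\<^sup>2 * (\<Psi>r (r, th1) + m th1 * (1 / r) * \<Psi>\<theta> (r, th1))\<^sup>2
                   + r\<^sup>2 * (\<Psi>r (r, th0))\<^sup>2))"

definition data_size ::
  "real \<Rightarrow> real \<Rightarrow> real \<Rightarrow> real \<Rightarrow>
   (real \<Rightarrow> real \<Rightarrow> real) \<Rightarrow> (real \<Rightarrow> real) \<Rightarrow> (real \<Rightarrow> real) \<Rightarrow> (real \<Rightarrow> real) \<Rightarrow> (real \<Rightarrow> real) \<Rightarrow> real" where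
  "data_size th0 th1 r0 r1 F g0 g1 h0 h1 =
     integral ({r0<..<r1} \<times> {th0<..<th1}) (\<lambda>(r, \<theta>). r ^ 4 * (F r \<theta>)\<^sup>2)
     + integral {th0..th1} (\<lambda>\<theta>. r1 ^ 3 * (g1 \<theta>)\<^sup>2 + r0 ^ 3 * (g0 \<theta>)\<^sup>2)
     + integral {r0..r1} (\<lambda>r. r\<^sup>2 * ((h0 r)\<^sup>2 + (h1 r)\<^sup>2))"

end

theory Submission
  imports Defs
begin

text \<open>
  The estimate is proved by the multiplier method. Let \<open>u = r \<partial>\<^sub>r\<Psi>\<close> and \<open>v = \<partial>\<^sub>\<theta>\<Psi>\<close>. In the variables
  \<open>(ln r, \<theta>)\<close> the equation has coefficients that depend on \<open>\<theta>\<close> only, and this homogeneity in \<open>r\<close> is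
  why the constant is independent of \<open>r\<^sub>0\<close> and \<open>r\<^sub>1\<close>. Put \<open>a = A\<^sub>1\<^sub>2 / A\<^sub>2\<^sub>2\<close>, \<open>k = k\<^sub>1\<^sub>1 = A\<^sub>1\<^sub>1 / A\<^sub>2\<^sub>2 - a\<^sup>2\<close>,
  \<open>D = \<partial>\<^sub>\<theta> + a r\<partial>\<^sub>r\<close> and \<open>w = D\<Psi> = v + a u\<close>. The equation times \<open>r\<^sup>2 / A\<^sub>2\<^sub>2\<close> reads
  \<open>D w + k r\<partial>\<^sub>r u + k u + k\<^sub>2 w = r\<^sup>2 F / A\<^sub>2\<^sub>2\<close>. That the coefficient of \<open>u\<close> is again \<open>k\<close> is a
  remarkable identity for the background flow (\<open>first_order_coefficient_identity\<close>).

  The multiplier \<open>l\<^sub>1 u + l\<^sub>2 v\<close> equals \<open>(d\<^sub>2 w - d\<^sub>1 u) / (f A\<^sub>2\<^sub>2)\<close>. The weight \<open>1 / f\<close> makes \<open>D\<close>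
  antisymmetric, and integration by parts (\<open>flux_identity\<close>) leaves in the interior the diagonal form
  \<open>(\<alpha> u\<^sup>2 + \<beta> w\<^sup>2) / f\<close> with \<open>\<alpha> = ((k d\<^sub>2)' - k d\<^sub>1) / 2\<close> and \<open>\<beta> = d\<^sub>* - d\<^sub>1 / 2\<close>. Both are at least 2 by
  the choice of \<open>d\<^sub>1\<close>, \<open>d\<^sub>2\<close> and \<open>d\<^sub>*\<close>, although \<open>k\<close> changes sign at the sonic angle.

  On the boundary, let \<open>z = u + (l\<^sub>2 / l\<^sub>1) v\<close>. The boundary forms are diagonal in \<open>(z, v)\<close> on the
  arcs and in \<open>(z, u)\<close> on the radial sides (\<open>radial_form_diagonal\<close>, \<open>angular_form_diagonal\<close>). Each is
  indefinite, with a coefficient proportional to \<open>K\<^sub>4\<close> on one square and a coefficient of the opposite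
  sign on the other, and on every side the boundary condition prescribes exactly the square with the
  unfavourable sign. Compactness of the interval of angles gives uniform constants, and Young's
  inequality absorbs the source term (\<open>energy_estimate\<close>).

  Uniqueness up to a constant follows since the difference of two solutions satisfies the
  same estimate with zero data, so that its gradient vanishes.
\<close>

section \<open>Calculus on rectangles\<close>

lemma cbox_rectangle: "cbox (a, c) (b, d) = {a..b} \<times> {c..d}" for a b c d :: real
  by (simp add: cbox_Pair_eq)

lemma box_rectangle: "box (a, c) (b, d) = {a<..<b} \<times> {c<..<d}" for a b c d :: real
  by (auto simp: box_def Basis_prod_def)

lemma integral_rectangle_interior:
  fixes f :: "real \<times> real \<Rightarrow> real"
  shows "integral ({a<..<b} \<times> {c<..<d}) f = integral ({a..b} \<times> {c..d}) f"
  using integral_open_interval[of "(a, c)" "(b, d)" f] by (simp add: cbox_rectangle box_rectangle)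

lemma integral_interval_cong_interior:
  fixes f g :: "real \<Rightarrow> real"
  assumes "\<And>x. x \<in> {a<..<b} \<Longrightarrow> f x = g x"
  shows "integral {a..b} f = integral {a..b} g"
  unfolding integral_open_interval_real using assms by (intro Henstock_Kurzweil_Integration.integral_cong) auto

lemma continuous_on_section:
  fixes f :: "real \<times> real \<Rightarrow> real"
  assumes "continuous_on (R \<times> T) f"
  shows "y \<in> T \<Longrightarrow> continuous_on R (\<lambda>x. f (x, y))" and "x \<in> R \<Longrightarrow> continuous_on T (\<lambda>y. f (x, y))"
  by (rule continuous_on_compose2[OF assms], auto intro!: continuous_intros)+

text \<open>Only the two partial derivatives in the divergence have to be continuous; the boundary terms
  come from the one-dimensional fundamental theorem on each section of the rectangle.\<close>

lemma divergence_theorem_rectangle: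
  fixes G H G' H' :: "real \<times> real \<Rightarrow> real"
  assumes ab: "a \<le> b" and cd: "c \<le> d"
    and G: "\<And>x y. x \<in> {a..b} \<Longrightarrow> y \<in> {c..d} \<Longrightarrow>
      ((\<lambda>x. G (x, y)) has_real_derivative G' (x, y)) (at x within {a..b})"
    and H: "\<And>x y. x \<in> {a..b} \<Longrightarrow> y \<in> {c..d} \<Longrightarrow>
      ((\<lambda>y. H (x, y)) has_real_derivative H' (x, y)) (at y within {c..d})"
    and cG: "continuous_on ({a..b} \<times> {c..d}) G'" and cH: "continuous_on ({a..b} \<times> {c..d}) H'"
  shows "integral ({a..b} \<times> {c..d}) (\<lambda>z. G' z + H' z) =
    integral {c..d} (\<lambda>y. G (b, y) - G (a, y)) + integral {a..b} (\<lambda>x. H (x, d) - H (x, c))"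
proof -
  have cG': "continuous_on (cbox (a, c) (b, d)) (\<lambda>(x, y). G' (x, y))"
    and cH': "continuous_on (cbox (a, c) (b, d)) (\<lambda>(x, y). H' (x, y))"
    using cG cH by (simp_all add: cbox_rectangle)
  have "integral ({a..b} \<times> {c..d}) G' = integral {a..b} (\<lambda>x. integral {c..d} (\<lambda>y. G' (x, y)))"
    using integral_prod_continuous[OF cG'] by (simp add: cbox_rectangle)
  also have "\<dots> = integral {c..d} (\<lambda>y. integral {a..b} (\<lambda>x. G' (x, y)))"
    using integral_swap_continuous[OF cG'] by simp
  also have "\<dots> = integral {c..d} (\<lambda>y. G (b, y) - G (a, y))"
  proof (rule Henstock_Kurzweil_Integration.integral_cong, rule integral_unique)
    fix y assume "y \<in> {c..d}"
    then show "((\<lambda>x. G' (x, y)) has_integral G (b, y) - G (a, y)) {a..b}"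
      using G by (intro fundamental_theorem_of_calculus ab)
        (auto simp: has_real_derivative_iff_has_vector_derivative)
  qed
  finally have 1: "integral ({a..b} \<times> {c..d}) G' = integral {c..d} (\<lambda>y. G (b, y) - G (a, y))" .
  have "integral ({a..b} \<times> {c..d}) H' = integral {a..b} (\<lambda>x. integral {c..d} (\<lambda>y. H' (x, y)))"
    using integral_prod_continuous[OF cH'] by (simp add: cbox_rectangle)
  also have "\<dots> = integral {a..b} (\<lambda>x. H (x, d) - H (x, c))"
  proof (rule Henstock_Kurzweil_Integration.integral_cong, rule integral_unique)
    fix x assume "x \<in> {a..b}"
    then show "((\<lambda>y. H' (x, y)) has_integral H (x, d) - H (x, c)) {c..d}"
      using H by (intro fundamental_theorem_of_calculus cd)
        (auto simp: has_real_derivative_iff_has_vector_derivative)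
  qed
  finally have 2: "integral ({a..b} \<times> {c..d}) H' = integral {a..b} (\<lambda>x. H (x, d) - H (x, c))" .
  have "G' integrable_on {a..b} \<times> {c..d}" "H' integrable_on {a..b} \<times> {c..d}"
    using integrable_continuous[of "(a, c)" "(b, d)"] cG cH by (simp_all add: cbox_rectangle)
  then show ?thesis using 1 2 by (simp add: Henstock_Kurzweil_Integration.integral_add)
qed

lemma has_real_derivative_unique_interval:
  fixes f :: "real \<Rightarrow> real"
  assumes "a < b" "x \<in> {a..b}"
    and "(f has_real_derivative D) (at x within {a..b})" "(f has_real_derivative E) (at x within {a..b})"
  shows "D = E"
  using vector_derivative_unique_within_closed_interval[of a b x f D E] assms
  by (simp add: has_real_derivative_iff_has_vector_derivative)

text \<open>Symmetry of the mixed derivatives up to the boundary, with one-sided derivatives. Writing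
  \<open>f(s, t) = f(a, t) + \<integral>\<^sub>a\<^sup>s f\<^sub>x(x, t) dx\<close> and differentiating under the integral sign gives
  \<open>f\<^sub>y(s, y) = f\<^sub>y(a, y) + \<integral>\<^sub>a\<^sup>s f\<^sub>x\<^sub>y(x, y) dx\<close>, which can be differentiated in \<open>s\<close>.\<close>

lemma mixed_partials_rectangle:
  fixes f fx fy fxy fyx :: "real \<times> real \<Rightarrow> real"
  assumes ab: "a < b" and cd: "c < d"
    and fx: "\<And>x y. x \<in> {a..b} \<Longrightarrow> y \<in> {c..d} \<Longrightarrow>
      ((\<lambda>x. f (x, y)) has_real_derivative fx (x, y)) (at x within {a..b})"
    and fy: "\<And>x y. x \<in> {a..b} \<Longrightarrow> y \<in> {c..d} \<Longrightarrow>
      ((\<lambda>y. f (x, y)) has_real_derivative fy (x, y)) (at y within {c..d})"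
    and fxy: "\<And>x y. x \<in> {a..b} \<Longrightarrow> y \<in> {c..d} \<Longrightarrow>
      ((\<lambda>y. fx (x, y)) has_real_derivative fxy (x, y)) (at y within {c..d})"
    and fyx: "\<And>x y. x \<in> {a..b} \<Longrightarrow> y \<in> {c..d} \<Longrightarrow>
      ((\<lambda>x. fy (x, y)) has_real_derivative fyx (x, y)) (at x within {a..b})"
    and cfx: "continuous_on ({a..b} \<times> {c..d}) fx" and cfxy: "continuous_on ({a..b} \<times> {c..d}) fxy"
    and x: "x \<in> {a..b}" and y: "y \<in> {c..d}"
  shows "fyx (x, y) = fxy (x, y)"
proof -
  have FTC: "integral {a..s} (\<lambda>x. fx (x, t)) = f (s, t) - f (a, t)" if "s \<in> {a..b}" "t \<in> {c..d}" for s t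
    using that fx[THEN DERIV_subset, of _ t "{a..s}"]
    by (intro integral_unique fundamental_theorem_of_calculus)
      (auto simp: has_real_derivative_iff_has_vector_derivative)
  have fy_eq: "fy (s, y) = fy (a, y) + integral {a..s} (\<lambda>x. fxy (x, y))" if s: "s \<in> {a..b}" for s
  proof -
    have sub: "{a..s} \<subseteq> {a..b}" using s by auto
    have "((\<lambda>t. integral (cbox a s) (\<lambda>x. fx (x, t))) has_real_derivative
        integral (cbox a s) (\<lambda>x. fxy (x, y))) (at y within {c..d})"
    proof (rule leibniz_rule_field_derivative)
      show "((\<lambda>t. fx (x, t)) has_real_derivative fxy (x, t)) (at t within {c..d})"
        if "t \<in> {c..d}" "x \<in> cbox a s" for t x
        using fxy that sub by auto
      show "(\<lambda>x. fx (x, t)) integrable_on cbox a s" if "t \<in> {c..d}" for t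
        using continuous_on_section(1)[OF cfx that] continuous_on_subset[OF _ sub]
        by (intro integrable_continuous) auto
      show "continuous_on ({c..d} \<times> cbox a s) (\<lambda>(t, x). fxy (x, t))"
        unfolding split_beta
        by (rule continuous_on_compose2[OF cfxy]) (use sub in \<open>auto intro!: continuous_intros\<close>)
    qed (use y in auto)
    then have "((\<lambda>t. f (s, t) - f (a, t)) has_real_derivative integral {a..s} (\<lambda>x. fxy (x, y)))
        (at y within {c..d})"
      using y s FTC by (auto intro: has_field_derivative_transform_within[OF _ zero_less_one])
    moreover have "((\<lambda>t. f (s, t) - f (a, t)) has_real_derivative fy (s, y) - fy (a, y))
        (at y within {c..d})"
      using fy s y ab by (intro derivative_intros) auto
    ultimately show ?thesis
      using has_real_derivative_unique_interval[OF cd y] by fastforce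
  qed
  have "((\<lambda>s. integral {a..s} (\<lambda>x. fxy (x, y))) has_real_derivative fxy (x, y)) (at x within {a..b})"
    using integral_has_vector_derivative[OF continuous_on_section(1)[OF cfxy y] x]
    by (simp add: has_real_derivative_iff_has_vector_derivative)
  then have "((\<lambda>s. fy (a, y) + integral {a..s} (\<lambda>x. fxy (x, y))) has_real_derivative fxy (x, y))
      (at x within {a..b})"
    by (auto intro!: derivative_eq_intros)
  then have "((\<lambda>s. fy (s, y)) has_real_derivative fxy (x, y)) (at x within {a..b})"
    by (rule has_field_derivative_transform_within[OF _ zero_less_one x]) (rule fy_eq[symmetric])
  then show ?thesis
    using fyx[OF x y] has_real_derivative_unique_interval[OF ab x] by blast
qed

section \<open>The energy estimate for a first-order system\<close>

text \<open>The pair \<open>(u, v)\<close> is the gradient of a function in the variables \<open>(ln r, \<theta>)\<close>. The integrability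
  condition \<open>\<partial>\<^sub>\<theta>u = r \<partial>\<^sub>rv\<close> is all that remains of the potential; in this form, solutions can be
  subtracted without differentiating a difference of potentials.\<close>

definition log_gradient where
  "log_gradient R T u v ur u\<theta> vr v\<theta> \<longleftrightarrow>
    (\<forall>r\<in>R. \<forall>\<theta>\<in>T.
      ((\<lambda>r. u (r, \<theta>)) has_real_derivative ur (r, \<theta>)) (at r within R) \<and>
      ((\<lambda>\<theta>. u (r, \<theta>)) has_real_derivative u\<theta> (r, \<theta>)) (at \<theta> within T) \<and>
      ((\<lambda>r. v (r, \<theta>)) has_real_derivative vr (r, \<theta>)) (at r within R) \<and>
      ((\<lambda>\<theta>. v (r, \<theta>)) has_real_derivative v\<theta> (r, \<theta>)) (at \<theta> within T) \<and>
      u\<theta> (r, \<theta>) = r * vr (r, \<theta>)) \<and>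
    (\<forall>g\<in>{u, v, ur, u\<theta>, vr, v\<theta>}. continuous_on (R \<times> T) g)"
  for R T :: "real set" and u v ur u\<theta> vr v\<theta> :: "real \<times> real \<Rightarrow> real"

lemma log_gradientD:
  assumes "log_gradient R T u v ur u\<theta> vr v\<theta>" and "r \<in> R" "\<theta> \<in> T"
  shows "((\<lambda>r. u (r, \<theta>)) has_real_derivative ur (r, \<theta>)) (at r within R)"
    "((\<lambda>\<theta>. u (r, \<theta>)) has_real_derivative u\<theta> (r, \<theta>)) (at \<theta> within T)"
    "((\<lambda>r. v (r, \<theta>)) has_real_derivative vr (r, \<theta>)) (at r within R)"
    "((\<lambda>\<theta>. v (r, \<theta>)) has_real_derivative v\<theta> (r, \<theta>)) (at \<theta> within T)"
    "u\<theta> (r, \<theta>) = r * vr (r, \<theta>)"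
  using assms unfolding log_gradient_def by blast+

lemma log_gradient_cont:
  assumes "log_gradient R T u v ur u\<theta> vr v\<theta>"
  shows "continuous_on (R \<times> T) u" "continuous_on (R \<times> T) v" "continuous_on (R \<times> T) ur"
    "continuous_on (R \<times> T) u\<theta>" "continuous_on (R \<times> T) vr" "continuous_on (R \<times> T) v\<theta>"
  using assms unfolding log_gradient_def by blast+

lemma integral_scaled_diff:
  fixes g h :: "real \<Rightarrow> real"
  assumes "g integrable_on S" "h integrable_on S"
  shows "integral S (\<lambda>x. c * g x - M * h x) = c * integral S g - M * integral S h"
  using assms by (intro integral_unique has_integral_diff has_integral_mult_right integrable_integral)

text \<open>The structure behind the choice of \<open>d\<^sub>1\<close> and \<open>d\<^sub>2\<close>. Here \<open>a = A\<^sub>1\<^sub>2 / A\<^sub>2\<^sub>2\<close>, \<open>k + a\<^sup>2 = A\<^sub>1\<^sub>1 / A\<^sub>2\<^sub>2\<close>, so that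
  \<open>r\<^sup>2 / A\<^sub>2\<^sub>2\<close> times the equation has the principal part of \<open>D\<^sup>2 + k (r\<partial>\<^sub>r)\<^sup>2\<close>, \<open>D = \<partial>\<^sub>\<theta> + a r\<partial>\<^sub>r\<close>, and \<open>\<kappa>'\<close> is
  the derivative of \<open>k d\<^sub>2\<close>. The function \<open>k\<close> may change sign (the equation is then of mixed type); the
  positivity of \<open>k + a\<^sup>2\<close> and of \<open>d\<^sub>1\<^sup>2 + k d\<^sub>2\<^sup>2\<close> is what controls the boundary terms, and
  the two lower bounds by 2 control the interior ones.\<close>

locale multiplier =
  fixes t0 t1 :: real and a a' k \<kappa>' k2 d1 d2 f A :: "real \<Rightarrow> real" and ds :: real
  assumes t0_less_t1: "t0 < t1"
    and a_deriv: "\<And>\<theta>. \<theta> \<in> {t0..t1} \<Longrightarrow> (a has_real_derivative a' \<theta>) (at \<theta> within {t0..t1})"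
    and kd_deriv: "\<And>\<theta>. \<theta> \<in> {t0..t1} \<Longrightarrow>
      ((\<lambda>\<theta>. k \<theta> * d2 \<theta>) has_real_derivative \<kappa>' \<theta>) (at \<theta> within {t0..t1})"
    and d1_deriv: "\<And>\<theta>. \<theta> \<in> {t0..t1} \<Longrightarrow>
      (d1 has_real_derivative k2 \<theta> * d1 \<theta>) (at \<theta> within {t0..t1})"
    and d2_deriv: "\<And>\<theta>. \<theta> \<in> {t0..t1} \<Longrightarrow>
      (d2 has_real_derivative 2 * k2 \<theta> * d2 \<theta> - 2 * ds) (at \<theta> within {t0..t1})"
    and f_deriv: "\<And>\<theta>. \<theta> \<in> {t0..t1} \<Longrightarrow>
      (f has_real_derivative a \<theta> * f \<theta>) (at \<theta> within {t0..t1})"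
    and a'_cont: "continuous_on {t0..t1} a'" and k_cont: "continuous_on {t0..t1} k"
    and \<kappa>'_cont: "continuous_on {t0..t1} \<kappa>'" and k2_cont: "continuous_on {t0..t1} k2"
    and A_cont: "continuous_on {t0..t1} A"
    and A_pos: "\<And>\<theta>. \<theta> \<in> {t0..t1} \<Longrightarrow> A \<theta> > 0"
    and f_pos: "\<And>\<theta>. \<theta> \<in> {t0..t1} \<Longrightarrow> f \<theta> > 0"
    and d2_pos: "\<And>\<theta>. \<theta> \<in> {t0..t1} \<Longrightarrow> d2 \<theta> > 0"
    and n_pos: "\<And>\<theta>. \<theta> \<in> {t0..t1} \<Longrightarrow> d1 \<theta> - a \<theta> * d2 \<theta> > 0"
    and radial_elliptic: "\<And>\<theta>. \<theta> \<in> {t0..t1} \<Longrightarrow> k \<theta> + (a \<theta>)\<^sup>2 > 0"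
    and J_pos: "\<And>\<theta>. \<theta> \<in> {t0..t1} \<Longrightarrow> (d1 \<theta>)\<^sup>2 + k \<theta> * (d2 \<theta>)\<^sup>2 > 0"
    and u_coercive: "\<And>\<theta>. \<theta> \<in> {t0..t1} \<Longrightarrow> (\<kappa>' \<theta> - k \<theta> * d1 \<theta>) / 2 \<ge> 2"
    and w_coercive: "\<And>\<theta>. \<theta> \<in> {t0..t1} \<Longrightarrow> ds - d1 \<theta> / 2 \<ge> 2"
begin

text \<open>With weight \<open>f\<close>, one has \<open>f A\<^sub>2\<^sub>2 l\<^sub>1 = - n\<close> and \<open>f A\<^sub>2\<^sub>2 l\<^sub>2 = d\<^sub>2\<close>. Hence \<open>m = l\<^sub>2 / l\<^sub>1\<close> is the
  coefficient in the oblique boundary conditions, and \<open>J = f n K\<^sub>4\<close>.\<close>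

definition n where "n \<theta> = d1 \<theta> - a \<theta> * d2 \<theta>"
definition J where "J \<theta> = (d1 \<theta>)\<^sup>2 + k \<theta> * (d2 \<theta>)\<^sup>2"
definition m where "m \<theta> = d2 \<theta> / (a \<theta> * d2 \<theta> - d1 \<theta>)"

text \<open>The two quadratic forms are the components of the flux whose divergence appears in the energy
  identity: the radial flux is \<open>r\<close> times the first one.\<close>

definition radial_form where
  "radial_form \<theta> x y = (- n \<theta> * (k \<theta> + (a \<theta>)\<^sup>2) * x\<^sup>2 / 2 + d2 \<theta> * (k \<theta> + (a \<theta>)\<^sup>2) * x * y
     + (a \<theta> * d2 \<theta> + n \<theta> / 2) * y\<^sup>2) / f \<theta>"

definition angular_form where
  "angular_form \<theta> x y = (d2 \<theta> * (y + a \<theta> * x)\<^sup>2 / 2 - k \<theta> * d2 \<theta> * x\<^sup>2 / 2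
     - d1 \<theta> * x * (y + a \<theta> * x)) / f \<theta>"

lemma m_eq: "\<theta> \<in> {t0..t1} \<Longrightarrow> m \<theta> = - d2 \<theta> / n \<theta>"
  unfolding m_def n_def by (metis minus_diff_eq minus_divide_divide minus_minus)

text \<open>The reason for the boundary conditions: in the oblique combination \<open>x + m y\<close> together with one
  of the two original components, both boundary forms lose their mixed term, and each is a
  difference of two squares. Prescribing the component with the unfavourable sign leaves control
  of the other one.\<close>

lemma radial_form_diagonal:
  assumes "\<theta> \<in> {t0..t1}"
  shows "radial_form \<theta> x y = J \<theta> / (2 * f \<theta> * n \<theta>) * y\<^sup>2
    - n \<theta> * (k \<theta> + (a \<theta>)\<^sup>2) / (2 * f \<theta>) * (x + m \<theta> * y)\<^sup>2"
proof -
  have nz: "n \<theta> \<noteq> 0" "f \<theta> \<noteq> 0" using assms n_pos f_pos by (force simp: n_def)+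
  have J: "J \<theta> = (n \<theta> + a \<theta> * d2 \<theta>)\<^sup>2 + k \<theta> * (d2 \<theta>)\<^sup>2" by (simp add: n_def J_def)
  show ?thesis unfolding m_eq[OF assms] radial_form_def J using nz
    by (simp add: field_simps power2_eq_square)
qed

lemma angular_form_diagonal:
  assumes "\<theta> \<in> {t0..t1}"
  shows "angular_form \<theta> x y = (n \<theta>)\<^sup>2 / (2 * f \<theta> * d2 \<theta>) * (x + m \<theta> * y)\<^sup>2
    - J \<theta> / (2 * f \<theta> * d2 \<theta>) * x\<^sup>2"
proof -
  have nz: "n \<theta> \<noteq> 0" "f \<theta> \<noteq> 0" "d2 \<theta> \<noteq> 0" using assms n_pos f_pos d2_pos by (force simp: n_def)+
  have J: "J \<theta> = (n \<theta> + a \<theta> * d2 \<theta>)\<^sup>2 + k \<theta> * (d2 \<theta>)\<^sup>2" and d1: "d1 \<theta> = n \<theta> + a \<theta> * d2 \<theta>"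
    by (simp_all add: n_def J_def)
  show ?thesis unfolding m_eq[OF assms] angular_form_def J d1 using nz
    by (simp add: field_simps power2_eq_square)
qed

lemmas coeff_cont = a'_cont k_cont \<kappa>'_cont k2_cont A_cont
  DERIV_continuous_on[OF a_deriv] DERIV_continuous_on[OF d1_deriv]
  DERIV_continuous_on[OF d2_deriv] DERIV_continuous_on[OF f_deriv]

lemma n_cont: "continuous_on {t0..t1} n" and J_cont: "continuous_on {t0..t1} J"
  and m_cont: "continuous_on {t0..t1} m"
proof -
  show n: "continuous_on {t0..t1} n" and "continuous_on {t0..t1} J"
    unfolding n_def J_def by (intro continuous_intros coeff_cont; simp)+
  have "continuous_on {t0..t1} (\<lambda>\<theta>. - d2 \<theta> / n \<theta>)"
    using n_pos by (intro continuous_intros coeff_cont n) (force simp: n_def)+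
  then show "continuous_on {t0..t1} m" by (rule continuous_on_eq) (simp add: m_eq)
qed

text \<open>One pair of constants for all coercivity and boundedness arguments. They depend only on the
  coefficients and on \<open>[t0, t1]\<close>, so neither \<open>r\<^sub>0\<close> nor \<open>r\<^sub>1\<close> can enter.\<close>

definition bounds where
  "bounds c M \<longleftrightarrow> c > 0 \<and> M > 0 \<and> (\<forall>\<theta>\<in>{t0..t1}.
     c \<le> 1 / (f \<theta> * (1 + (a \<theta>)\<^sup>2)) \<and>
     ((n \<theta>)\<^sup>2 + (d2 \<theta>)\<^sup>2) / (f \<theta> * A \<theta>)\<^sup>2 \<le> M \<and>
     J \<theta> / (2 * f \<theta> * n \<theta>) \<in> {c..M} \<and>
     n \<theta> * (k \<theta> + (a \<theta>)\<^sup>2) / (2 * f \<theta>) \<in> {c..M} \<and>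
     (n \<theta>)\<^sup>2 / (2 * f \<theta> * d2 \<theta>) \<in> {c..M} \<and>
     J \<theta> / (2 * f \<theta> * d2 \<theta>) \<in> {c..M})"

lemma bounds_exist: "\<exists>c M. bounds c M"
proof -
  define gs where "gs = [\<lambda>\<theta>. 1 / (f \<theta> * (1 + (a \<theta>)\<^sup>2)), \<lambda>\<theta>. ((n \<theta>)\<^sup>2 + (d2 \<theta>)\<^sup>2) / (f \<theta> * A \<theta>)\<^sup>2,
    \<lambda>\<theta>. J \<theta> / (2 * f \<theta> * n \<theta>), \<lambda>\<theta>. n \<theta> * (k \<theta> + (a \<theta>)\<^sup>2) / (2 * f \<theta>),
    \<lambda>\<theta>. (n \<theta>)\<^sup>2 / (2 * f \<theta> * d2 \<theta>), \<lambda>\<theta>. J \<theta> / (2 * f \<theta> * d2 \<theta>)]"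
  have nz: "1 + (a \<theta>)\<^sup>2 > 0" for \<theta> by (simp add: add_pos_nonneg)
  have pos: "n \<theta> > 0" "J \<theta> > 0" "(n \<theta>)\<^sup>2 + (d2 \<theta>)\<^sup>2 > 0" if "\<theta> \<in> {t0..t1}" for \<theta>
    using n_pos[OF that] J_pos[OF that] by (auto simp: n_def J_def sum_power2_gt_zero_iff)
  have "\<exists>c>0. \<exists>M>0. \<forall>\<theta>\<in>{t0..t1}. c \<le> g \<theta> \<and> g \<theta> \<le> M" if "g \<in> set gs" for g
  proof -
    have cont: "continuous_on {t0..t1} g" and gpos: "\<And>\<theta>. \<theta> \<in> {t0..t1} \<Longrightarrow> g \<theta> > 0"
      using that pos f_pos d2_pos A_pos nz radial_elliptic unfolding gs_def
      by (auto intro!: continuous_intros coeff_cont n_cont J_cont mult_pos_pos divide_pos_pos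
        simp: less_imp_neq[symmetric] less_imp_neq[OF nz, symmetric])
    obtain x where x: "x \<in> {t0..t1}" "\<And>y. y \<in> {t0..t1} \<Longrightarrow> g x \<le> g y"
      using continuous_attains_inf[OF compact_Icc _ cont] t0_less_t1 by force
    obtain z where z: "z \<in> {t0..t1}" "\<And>y. y \<in> {t0..t1} \<Longrightarrow> g y \<le> g z"
      using continuous_attains_sup[OF compact_Icc _ cont] t0_less_t1 by force
    show ?thesis using x z gpos by blast
  qed
  then obtain cs Ms where cM: "\<And>g. g \<in> set gs \<Longrightarrow> cs g > 0" "\<And>g. g \<in> set gs \<Longrightarrow> Ms g > 0"
    "\<And>g \<theta>. g \<in> set gs \<Longrightarrow> \<theta> \<in> {t0..t1} \<Longrightarrow> cs g \<le> g \<theta> \<and> g \<theta> \<le> Ms g"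
    by metis
  define c M where "c = Min (cs ` set gs)" and "M = Max (Ms ` set gs)"
  have ne: "set gs \<noteq> {}" by (simp add: gs_def)
  have "c > 0" using cM(1) ne by (simp add: c_def)
  moreover have "M > 0" using cM(2)[of "hd gs"] by (auto simp: M_def Max_gr_iff gs_def)
  moreover have *: "g \<theta> \<in> {c..M}" if "g \<in> set gs" "\<theta> \<in> {t0..t1}" for g \<theta>
  proof -
    have "c \<le> cs g" "Ms g \<le> M" using that by (simp_all add: c_def M_def)
    then show ?thesis using cM(3)[OF that] by auto
  qed
  moreover have "list_all (\<lambda>g. \<forall>\<theta>\<in>{t0..t1}. g \<theta> \<in> {c..M}) gs"
    using * by (auto simp: list_all_iff)
  ultimately have "bounds c M"
    unfolding bounds_def gs_def by simp
  then show ?thesis by blast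
qed

lemma snd_cont:
  assumes "continuous_on {t0..t1} (g :: real \<Rightarrow> real)"
  shows "continuous_on (R \<times> {t0..t1}) (\<lambda>z. g (snd z))"
  by (rule continuous_on_compose2[OF assms]) (auto intro!: continuous_intros)

context
  fixes u v ur u\<theta> vr v\<theta> :: "real \<times> real \<Rightarrow> real"
begin

text \<open>The differential operator of the boundary value problem multiplied by \<open>r\<^sup>2 / A\<^sub>2\<^sub>2\<close>, in terms of
  \<open>u = r \<partial>\<^sub>r\<Psi>\<close> and \<open>v = \<partial>\<^sub>\<theta>\<Psi>\<close>; equivalently \<open>D w + k r\<partial>\<^sub>r u + k u + k\<^sub>2 w\<close> with \<open>w = v + a u\<close>.\<close>

definition oper where
  "oper z = (let \<theta> = snd z in v\<theta> z + 2 * a \<theta> * u\<theta> z + (k \<theta> + (a \<theta>)\<^sup>2) * fst z * ur z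
     + (a' \<theta> + k \<theta> + a \<theta> * k2 \<theta>) * u z + k2 \<theta> * v z)"

definition radial_flux where "radial_flux z = fst z * radial_form (snd z) (u z) (v z)"
definition angular_flux where "angular_flux z = angular_form (snd z) (u z) (v z)"

definition radial_flux' where
  "radial_flux' z = (let \<theta> = snd z; E = k \<theta> + (a \<theta>)\<^sup>2 in radial_form \<theta> (u z) (v z)
     + fst z * (- n \<theta> * E * u z * ur z + d2 \<theta> * E * (ur z * v z + u z * vr z)
         + (2 * a \<theta> * d2 \<theta> + n \<theta>) * v z * vr z) / f \<theta>)"

definition angular_flux' where
  "angular_flux' z = (let \<theta> = snd z; w = v z + a \<theta> * u z;
       w\<theta> = v\<theta> z + a' \<theta> * u z + a \<theta> * u\<theta> z in
     ((2 * k2 \<theta> * d2 \<theta> - 2 * ds) * w\<^sup>2 / 2 + d2 \<theta> * w * w\<theta> - \<kappa>' \<theta> * (u z)\<^sup>2 / 2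
       - k \<theta> * d2 \<theta> * u z * u\<theta> z - k2 \<theta> * d1 \<theta> * u z * w - d1 \<theta> * u\<theta> z * w - d1 \<theta> * u z * w\<theta>) / f \<theta>
     - a \<theta> * angular_form \<theta> (u z) (v z))"

definition slanted where "slanted z = u z + m (snd z) * v z"

context
  fixes r0 r1 :: real
  assumes r0_pos: "0 < r0" and r0_less_r1: "r0 < r1"
    and grad: "log_gradient {r0..r1} {t0..t1} u v ur u\<theta> vr v\<theta>"
begin

lemmas grad_simps = log_gradientD[OF grad]

lemmas grad_cont = log_gradient_cont[OF grad]

lemma radial_flux_deriv:
  assumes "r \<in> {r0..r1}" "\<theta> \<in> {t0..t1}"
  shows "((\<lambda>r. radial_flux (r, \<theta>)) has_real_derivative radial_flux' (r, \<theta>)) (at r within {r0..r1})"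
proof -
  have "f \<theta> \<noteq> 0" using f_pos assms by force
  show ?thesis
    unfolding radial_flux_def radial_flux'_def radial_form_def fst_conv snd_conv Let_def
    using \<open>f \<theta> \<noteq> 0\<close> by (auto intro!: grad_simps(1,3)[OF assms] derivative_eq_intros
      simp: field_simps power2_eq_square)
qed

lemma angular_flux_deriv:
  assumes "r \<in> {r0..r1}" "\<theta> \<in> {t0..t1}"
  shows "((\<lambda>\<theta>. angular_flux (r, \<theta>)) has_real_derivative angular_flux' (r, \<theta>)) (at \<theta> within {t0..t1})"
proof -
  have "f \<theta> \<noteq> 0" using f_pos assms by force
  show ?thesis
    unfolding angular_flux_def angular_flux'_def angular_form_def fst_conv snd_conv Let_def
    by (rule grad_simps(2,4)[OF assms] a_deriv[OF assms(2)] kd_deriv[OF assms(2)]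
        d1_deriv[OF assms(2)] d2_deriv[OF assms(2)] f_deriv[OF assms(2)]
        numeral_neq_zero derivative_eq_intros refl | fact)+
      (use \<open>f \<theta> \<noteq> 0\<close> in \<open>simp add: field_simps power2_eq_square\<close>)
qed

lemma flux_cont:
  "continuous_on ({r0..r1} \<times> {t0..t1}) radial_flux'"
  "continuous_on ({r0..r1} \<times> {t0..t1}) angular_flux'"
  "continuous_on ({r0..r1} \<times> {t0..t1}) oper"
proof -
  have "f (snd z) \<noteq> 0" if "z \<in> {r0..r1} \<times> {t0..t1}" for z
    using f_pos[of "snd z"] that by auto
  then show "continuous_on ({r0..r1} \<times> {t0..t1}) radial_flux'"
    "continuous_on ({r0..r1} \<times> {t0..t1}) angular_flux'"
    "continuous_on ({r0..r1} \<times> {t0..t1}) oper"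
    unfolding radial_flux'_def angular_flux'_def radial_form_def angular_form_def oper_def Let_def
    by (intro continuous_intros grad_cont snd_cont coeff_cont n_cont; simp)+
qed

text \<open>The energy identity. Since \<open>f' = a f\<close>, the operator \<open>D\<close> is antisymmetric for the
  measure \<open>dr d\<theta> / f\<close>, while the adjoint of \<open>r\<partial>\<^sub>r\<close> is \<open>- r\<partial>\<^sub>r - 1\<close>; also \<open>r\<partial>\<^sub>rw = D u\<close>. Multiplying
  by \<open>d\<^sub>2 w - d\<^sub>1 u\<close> and integrating by parts, the terms in \<open>u w\<close> cancel: those from the zeroth-order
  coefficient \<open>k\<close> against those from \<open>k r\<partial>\<^sub>r u\<close>, and \<open>k\<^sub>2 d\<^sub>1\<close> against \<open>d\<^sub>1'\<close>. The equation
  \<open>d\<^sub>2' = 2 k\<^sub>2 d\<^sub>2 - 2 d\<^sub>*\<close> turns the coefficient of \<open>w\<^sup>2\<close> into \<open>d\<^sub>* - d\<^sub>1 / 2\<close>.\<close>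

lemma flux_identity:
  assumes "r \<in> {r0..r1}" "\<theta> \<in> {t0..t1}"
  defines "z \<equiv> (r, \<theta>)"
  defines "w \<equiv> v z + a \<theta> * u z"
  shows "radial_flux' z + angular_flux' z = (d2 \<theta> * w - d1 \<theta> * u z) / f \<theta> * oper z
    - ((\<kappa>' \<theta> - k \<theta> * d1 \<theta>) / 2 * (u z)\<^sup>2 + (ds - d1 \<theta> / 2) * w\<^sup>2) / f \<theta>"
proof -
  have "f \<theta> \<noteq> 0" using f_pos assms by force
  show ?thesis
    unfolding radial_flux'_def angular_flux'_def radial_form_def angular_form_def oper_def Let_def
      z_def w_def n_def fst_conv snd_conv grad_simps(5)[OF assms(1,2)] using \<open>f \<theta> \<noteq> 0\<close>
    by (simp add: field_simps power2_eq_square)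
qed

text \<open>Young's inequality in the energy identity; half of the coercive term absorbs the product with
  the source.\<close>

lemma pointwise_estimate:
  assumes cM: "bounds c M" and z: "z \<in> {r0..r1} \<times> {t0..t1}"
  shows "c / 2 * ((u z)\<^sup>2 + (v z)\<^sup>2)
    \<le> M / (2 * c) * (A (snd z) * oper z)\<^sup>2 - (radial_flux' z + angular_flux' z)"
proof -
  obtain r \<theta> where z_eq: "z = (r, \<theta>)" and r: "r \<in> {r0..r1}" and \<theta>: "\<theta> \<in> {t0..t1}"
    using z by auto
  define U V X w where "U = u z" and "V = v z" and "X = A \<theta> * oper z" and "w = V + a \<theta> * U"
  note defs = U_def V_def X_def w_def
  define p q where "p = - n \<theta> / (f \<theta> * A \<theta>)" and "q = d2 \<theta> / (f \<theta> * A \<theta>)"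
  have pos: "f \<theta> > 0" "A \<theta> > 0" "c > 0" and nz: "1 + (a \<theta>)\<^sup>2 > 0"
    using f_pos A_pos \<theta> cM by (auto simp: bounds_def add_pos_nonneg)
  have c: "c \<le> 1 / (f \<theta> * (1 + (a \<theta>)\<^sup>2))" and M: "p\<^sup>2 + q\<^sup>2 \<le> M"
    using cM \<theta> unfolding bounds_def p_def q_def
    by (auto simp: power_divide add_divide_distrib)
  \<comment> \<open>Parallelogram identity for \<open>V = w - a U\<close>: control of \<open>(U, w)\<close> gives control of \<open>(U, V)\<close>.\<close>
  have "U\<^sup>2 + V\<^sup>2 = U\<^sup>2 + 2 * (w\<^sup>2 + (a \<theta>)\<^sup>2 * U\<^sup>2) - (w + a \<theta> * U)\<^sup>2"
    by (simp add: w_def power2_eq_square algebra_simps)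
  also have "\<dots> \<le> 2 * (1 + (a \<theta>)\<^sup>2) * (U\<^sup>2 + w\<^sup>2)"
    using zero_le_power2[of "w + a \<theta> * U"] zero_le_power2[of U]
      mult_nonneg_nonneg[OF zero_le_power2[of "a \<theta>"] zero_le_power2[of w]]
    by (simp add: algebra_simps)
  finally have "c * (U\<^sup>2 + V\<^sup>2) \<le> c * (2 * (1 + (a \<theta>)\<^sup>2) * (U\<^sup>2 + w\<^sup>2))"
    using pos by (simp add: mult_left_mono)
  also have "\<dots> \<le> 1 / (f \<theta> * (1 + (a \<theta>)\<^sup>2)) * (2 * (1 + (a \<theta>)\<^sup>2) * (U\<^sup>2 + w\<^sup>2))"
    using c nz by (intro mult_right_mono) auto
  also have "\<dots> = (2 * U\<^sup>2 + 2 * w\<^sup>2) / f \<theta>"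
  proof -
    have "1 / (F * E) * (2 * E * Y) = 2 * Y / F" if "E > 0" "F > 0" for E F Y :: real
      using that by simp
    from this[OF nz pos(1)] show ?thesis by (simp only: distrib_left[of 2 "U\<^sup>2" "w\<^sup>2"])
  qed
  also have "\<dots> \<le> ((\<kappa>' \<theta> - k \<theta> * d1 \<theta>) / 2 * U\<^sup>2 + (ds - d1 \<theta> / 2) * w\<^sup>2) / f \<theta>"
    using pos u_coercive[OF \<theta>] w_coercive[OF \<theta>]
    by (intro divide_right_mono add_mono mult_right_mono) auto
  finally have Q: "c * (U\<^sup>2 + V\<^sup>2)
    \<le> ((\<kappa>' \<theta> - k \<theta> * d1 \<theta>) / 2 * U\<^sup>2 + (ds - d1 \<theta> / 2) * w\<^sup>2) / f \<theta>" .
  have "(d2 \<theta> * w - d1 \<theta> * U) / f \<theta> * oper z = (p * U + q * V) * X"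
    using pos by (simp add: defs p_def q_def n_def field_simps)
  also have "\<dots> \<le> c / 2 * (U\<^sup>2 + V\<^sup>2) + (p\<^sup>2 + q\<^sup>2) / (2 * c) * X\<^sup>2"
  proof -
    have "0 \<le> ((c * U - p * X)\<^sup>2 + (c * V - q * X)\<^sup>2) / (2 * c)"
      using pos by simp
    also have "\<dots> = c / 2 * (U\<^sup>2 + V\<^sup>2) + (p\<^sup>2 + q\<^sup>2) / (2 * c) * X\<^sup>2 - (p * U + q * V) * X"
      using pos by (simp add: field_simps power2_eq_square)
    finally show ?thesis by simp
  qed
  also have "\<dots> \<le> c / 2 * (U\<^sup>2 + V\<^sup>2) + M / (2 * c) * X\<^sup>2"
    using M pos by (intro add_left_mono mult_right_mono divide_right_mono) auto
  finally show ?thesis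
    using Q flux_identity[OF r \<theta>, folded z_eq] by (simp add: defs z_eq algebra_simps)
qed

lemma slanted_cont: "continuous_on ({r0..r1} \<times> {t0..t1}) slanted"
  unfolding slanted_def by (intro continuous_intros grad_cont snd_cont m_cont)

lemma flux_cont':
  "continuous_on ({r0..r1} \<times> {t0..t1}) radial_flux"
  "continuous_on ({r0..r1} \<times> {t0..t1}) angular_flux"
proof -
  have "f (snd z) \<noteq> 0" if "z \<in> {r0..r1} \<times> {t0..t1}" for z
    using f_pos[of "snd z"] that by auto
  then show "continuous_on ({r0..r1} \<times> {t0..t1}) radial_flux"
    "continuous_on ({r0..r1} \<times> {t0..t1}) angular_flux"
    unfolding radial_flux_def angular_flux_def radial_form_def angular_form_def
    by (intro continuous_intros grad_cont snd_cont coeff_cont n_cont; simp)+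
qed

text \<open>The circle \<open>r = r\<^sub>1\<close> carries the oblique condition and \<open>r = r\<^sub>0\<close> the tangential one, since the
  outward flux has opposite signs there; likewise for the two radial sides.\<close>

lemma radial_boundary:
  assumes cM: "bounds c M" and \<theta>: "\<theta> \<in> {t0..t1}"
  shows "c * (r0 * (slanted (r0, \<theta>))\<^sup>2 + r1 * (v (r1, \<theta>))\<^sup>2)
     - M * (r1 * (slanted (r1, \<theta>))\<^sup>2 + r0 * (v (r0, \<theta>))\<^sup>2)
    \<le> radial_flux (r1, \<theta>) - radial_flux (r0, \<theta>)"
proof -
  define j b where "j = J \<theta> / (2 * f \<theta> * n \<theta>)" and "b = n \<theta> * (k \<theta> + (a \<theta>)\<^sup>2) / (2 * f \<theta>)"
  have jb: "c \<le> j" "j \<le> M" "c \<le> b" "b \<le> M"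
    using cM \<theta> by (auto simp: bounds_def j_def b_def)
  have flux: "radial_flux (r, \<theta>) = j * (r * (v (r, \<theta>))\<^sup>2) - b * (r * (slanted (r, \<theta>))\<^sup>2)" for r
    by (simp add: radial_flux_def radial_form_diagonal[OF \<theta>] slanted_def j_def b_def algebra_simps)
  have "c * (r1 * (v (r1, \<theta>))\<^sup>2) \<le> j * (r1 * (v (r1, \<theta>))\<^sup>2)"
    "c * (r0 * (slanted (r0, \<theta>))\<^sup>2) \<le> b * (r0 * (slanted (r0, \<theta>))\<^sup>2)"
    "b * (r1 * (slanted (r1, \<theta>))\<^sup>2) \<le> M * (r1 * (slanted (r1, \<theta>))\<^sup>2)"
    "j * (r0 * (v (r0, \<theta>))\<^sup>2) \<le> M * (r0 * (v (r0, \<theta>))\<^sup>2)"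
    using jb r0_pos r0_less_r1 by (intro mult_right_mono; simp)+
  then show ?thesis unfolding flux distrib_left by linarith
qed

lemma angular_boundary:
  assumes cM: "bounds c M"
  shows "c * ((slanted (r, t1))\<^sup>2 + (u (r, t0))\<^sup>2) - M * ((slanted (r, t0))\<^sup>2 + (u (r, t1))\<^sup>2)
    \<le> angular_flux (r, t1) - angular_flux (r, t0)"
proof -
  define j b where "j \<theta> = J \<theta> / (2 * f \<theta> * d2 \<theta>)" and "b \<theta> = (n \<theta>)\<^sup>2 / (2 * f \<theta> * d2 \<theta>)" for \<theta>
  have t: "t0 \<in> {t0..t1}" "t1 \<in> {t0..t1}" using t0_less_t1 by auto
  have jb: "c \<le> j \<theta>" "j \<theta> \<le> M" "c \<le> b \<theta>" "b \<theta> \<le> M" if "\<theta> \<in> {t0..t1}" for \<theta>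
    using cM that by (auto simp: bounds_def j_def b_def)
  have flux: "angular_flux (r, \<theta>) = b \<theta> * (slanted (r, \<theta>))\<^sup>2 - j \<theta> * (u (r, \<theta>))\<^sup>2"
    if "\<theta> \<in> {t0..t1}" for \<theta>
    by (simp add: angular_flux_def angular_form_diagonal[OF that] slanted_def j_def b_def)
  have "c * (slanted (r, t1))\<^sup>2 \<le> b t1 * (slanted (r, t1))\<^sup>2"
    "c * (u (r, t0))\<^sup>2 \<le> j t0 * (u (r, t0))\<^sup>2"
    "b t0 * (slanted (r, t0))\<^sup>2 \<le> M * (slanted (r, t0))\<^sup>2"
    "j t1 * (u (r, t1))\<^sup>2 \<le> M * (u (r, t1))\<^sup>2"
    using jb t by (intro mult_right_mono; simp)+
  then show ?thesis unfolding flux[OF t(1)] flux[OF t(2)] distrib_left by linarith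
qed

lemma integrated_estimate:
  assumes cM: "bounds c M"
  shows "integral ({r0..r1} \<times> {t0..t1}) (\<lambda>z. (u z)\<^sup>2 + (v z)\<^sup>2)
      + integral {t0..t1} (\<lambda>\<theta>. r0 * (slanted (r0, \<theta>))\<^sup>2 + r1 * (v (r1, \<theta>))\<^sup>2)
      + integral {r0..r1} (\<lambda>r. (slanted (r, t1))\<^sup>2 + (u (r, t0))\<^sup>2)
    \<le> 2 / c * (M / (2 * c) + M) *
      (integral ({r0..r1} \<times> {t0..t1}) (\<lambda>z. (A (snd z) * oper z)\<^sup>2)
      + integral {t0..t1} (\<lambda>\<theta>. r1 * (slanted (r1, \<theta>))\<^sup>2 + r0 * (v (r0, \<theta>))\<^sup>2)
      + integral {r0..r1} (\<lambda>r. (slanted (r, t0))\<^sup>2 + (u (r, t1))\<^sup>2))"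
    (is "?Ei + ?Et + ?Er \<le> _ * (?Di + ?Dt + ?Dr)")
proof -
  let ?S = "{r0..r1} \<times> {t0..t1}"
  have c: "c > 0" and M: "M > 0" using cM by (auto simp: bounds_def)
  have t: "t0 \<in> {t0..t1}" "t1 \<in> {t0..t1}" and r: "r0 \<in> {r0..r1}" "r1 \<in> {r0..r1}"
    using t0_less_t1 r0_less_r1 by auto
  note int2 = integrable_continuous[of "(r0, t0)" "(r1, t1)", unfolded cbox_rectangle]
  note int1 = integrable_continuous_real
  note sect = continuous_on_section(1)[OF grad_cont(1)] continuous_on_section(2)[OF grad_cont(2)]
    continuous_on_section[OF slanted_cont] continuous_on_section[OF flux_cont'(1)]
    continuous_on_section[OF flux_cont'(2)]
  have "c / 2 * ?Ei \<le> M / (2 * c) * ?Di - integral ?S (\<lambda>z. radial_flux' z + angular_flux' z)"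
  proof -
    have "integral ?S (\<lambda>z. c / 2 * ((u z)\<^sup>2 + (v z)\<^sup>2)) \<le>
      integral ?S (\<lambda>z. M / (2 * c) * (A (snd z) * oper z)\<^sup>2 - (radial_flux' z + angular_flux' z))"
      using pointwise_estimate[OF cM]
      by (intro integral_le int2 continuous_intros grad_cont flux_cont snd_cont A_cont)
    also have "\<dots> = integral ?S (\<lambda>z. M / (2 * c) * (A (snd z) * oper z)\<^sup>2)
        - integral ?S (\<lambda>z. radial_flux' z + angular_flux' z)"
      by (intro Henstock_Kurzweil_Integration.integral_diff int2 continuous_intros flux_cont snd_cont A_cont)
    finally show ?thesis by simp
  qed
  also have "integral ?S (\<lambda>z. radial_flux' z + angular_flux' z) =
      integral {t0..t1} (\<lambda>\<theta>. radial_flux (r1, \<theta>) - radial_flux (r0, \<theta>))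
      + integral {r0..r1} (\<lambda>r. angular_flux (r, t1) - angular_flux (r, t0))"
    using t0_less_t1 r0_less_r1 radial_flux_deriv angular_flux_deriv flux_cont(1,2)
    by (intro divergence_theorem_rectangle) auto
  finally have 1: "c / 2 * ?Ei \<le> M / (2 * c) * ?Di
      - (integral {t0..t1} (\<lambda>\<theta>. radial_flux (r1, \<theta>) - radial_flux (r0, \<theta>))
      + integral {r0..r1} (\<lambda>r. angular_flux (r, t1) - angular_flux (r, t0)))" .
  have "integral {t0..t1} (\<lambda>\<theta>. c * (r0 * (slanted (r0, \<theta>))\<^sup>2 + r1 * (v (r1, \<theta>))\<^sup>2)
      - M * (r1 * (slanted (r1, \<theta>))\<^sup>2 + r0 * (v (r0, \<theta>))\<^sup>2))
    \<le> integral {t0..t1} (\<lambda>\<theta>. radial_flux (r1, \<theta>) - radial_flux (r0, \<theta>))"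
    using radial_boundary[OF cM] by (intro integral_le int1 continuous_intros sect t r)
  also have "integral {t0..t1} (\<lambda>\<theta>. c * (r0 * (slanted (r0, \<theta>))\<^sup>2 + r1 * (v (r1, \<theta>))\<^sup>2)
      - M * (r1 * (slanted (r1, \<theta>))\<^sup>2 + r0 * (v (r0, \<theta>))\<^sup>2)) = c * ?Et - M * ?Dt"
    by (intro integral_scaled_diff int1 continuous_intros sect t r)
  finally have 2: "c * ?Et - M * ?Dt
      \<le> integral {t0..t1} (\<lambda>\<theta>. radial_flux (r1, \<theta>) - radial_flux (r0, \<theta>))" .
  have "integral {r0..r1} (\<lambda>r. c * ((slanted (r, t1))\<^sup>2 + (u (r, t0))\<^sup>2)
      - M * ((slanted (r, t0))\<^sup>2 + (u (r, t1))\<^sup>2))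
    \<le> integral {r0..r1} (\<lambda>r. angular_flux (r, t1) - angular_flux (r, t0))"
    using angular_boundary[OF cM] by (intro integral_le int1 continuous_intros sect t r)
  also have "integral {r0..r1} (\<lambda>r. c * ((slanted (r, t1))\<^sup>2 + (u (r, t0))\<^sup>2)
      - M * ((slanted (r, t0))\<^sup>2 + (u (r, t1))\<^sup>2)) = c * ?Er - M * ?Dr"
    by (intro integral_scaled_diff int1 continuous_intros sect t r)
  finally have 3: "c * ?Er - M * ?Dr
      \<le> integral {r0..r1} (\<lambda>r. angular_flux (r, t1) - angular_flux (r, t0))" .
  have nonneg: "0 \<le> ?Di" "0 \<le> ?Dt" "0 \<le> ?Dr" "0 \<le> ?Et" "0 \<le> ?Er"
    using r0_pos r0_less_r1
    by (auto intro!: integral_nonneg int1 int2 continuous_intros flux_cont snd_cont A_cont sect t r)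
  have "c / 2 * (?Ei + ?Et + ?Er) \<le> c / 2 * ?Ei + c * ?Et + c * ?Er"
  proof -
    have "c / 2 * (x + y + z) \<le> c / 2 * x + c * y + c * z" if "0 \<le> y" "0 \<le> z" for x y z
    proof -
      have "c / 2 * (x + y + z) = c / 2 * x + c * y + c * z - c / 2 * (y + z)"
        by (simp add: field_simps)
      then show ?thesis using c that by simp
    qed
    then show ?thesis using nonneg by blast
  qed
  also have "\<dots> \<le> M / (2 * c) * ?Di + M * (?Dt + ?Dr)"
    using 1 2 3 by (simp add: distrib_left)
  also have "\<dots> \<le> (M / (2 * c) + M) * ?Di + (M / (2 * c) + M) * (?Dt + ?Dr)"
    using c M nonneg by (intro add_mono mult_right_mono) auto
  also have "\<dots> = (M / (2 * c) + M) * (?Di + ?Dt + ?Dr)" by (simp add: algebra_simps)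
  finally have "2 / c * (c / 2 * (?Ei + ?Et + ?Er)) \<le> 2 / c * ((M / (2 * c) + M) * (?Di + ?Dt + ?Dr))"
    using c by (intro mult_left_mono) auto
  moreover have "2 / c * (c / 2 * x) = x" for x using c by simp
  ultimately show ?thesis by (simp only: mult.assoc)
qed

end

end

theorem energy_estimate:
  "\<exists>C>0. \<forall>r0 r1 u v ur u\<theta> vr v\<theta>.
    0 < r0 \<and> r0 < r1 \<and> log_gradient {r0..r1} {t0..t1} u v ur u\<theta> vr v\<theta> \<longrightarrow>
      integral ({r0..r1} \<times> {t0..t1}) (\<lambda>z. (u z)\<^sup>2 + (v z)\<^sup>2)
      + integral {t0..t1} (\<lambda>\<theta>. r0 * (u (r0, \<theta>) + m \<theta> * v (r0, \<theta>))\<^sup>2 + r1 * (v (r1, \<theta>))\<^sup>2)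
      + integral {r0..r1} (\<lambda>r. (u (r, t1) + m t1 * v (r, t1))\<^sup>2 + (u (r, t0))\<^sup>2)
    \<le> C * (integral ({r0..r1} \<times> {t0..t1}) (\<lambda>z. (A (snd z) * oper u v ur u\<theta> v\<theta> z)\<^sup>2)
      + integral {t0..t1} (\<lambda>\<theta>. r1 * (u (r1, \<theta>) + m \<theta> * v (r1, \<theta>))\<^sup>2 + r0 * (v (r0, \<theta>))\<^sup>2)
      + integral {r0..r1} (\<lambda>r. (u (r, t0) + m t0 * v (r, t0))\<^sup>2 + (u (r, t1))\<^sup>2))"
proof -
  obtain c M where cM: "bounds c M" using bounds_exist by blast
  then have pos: "c > 0" "M > 0" by (auto simp: bounds_def)
  show ?thesis
  proof (intro exI[of _ "2 / c * (M / (2 * c) + M)"] conjI allI impI, goal_cases)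
    case 1
    then show ?case using pos by (simp add: add_pos_pos)
  next
    case (2 r0 r1 u v ur u\<theta> vr v\<theta>)
    then have grad: "0 < r0" "r0 < r1" "log_gradient {r0..r1} {t0..t1} u v ur u\<theta> vr v\<theta>" by auto
    show ?case
      using integrated_estimate[OF grad cM] unfolding slanted_def snd_conv .
  qed
qed

end

section \<open>Coefficients of the background flow\<close>

text \<open>The cancellation of the mixed terms needs the zeroth-order coefficient of \<open>u\<close> in the normalised
  operator to be \<open>k + a' + a k\<^sub>2\<close>, where \<open>a'\<close> is computed from the differential equations of the
  background flow. This is a rational identity in the velocity \<open>(x, y)\<close>, the squared sound speed
  \<open>c\<close>, the exponent \<open>\<gamma>\<close> and \<open>\<kappa> = cot \<theta>\<close>; the value \<open>e\<close> is \<open>k\<^sub>2\<close>, and \<open>G\<close> is the quotient in the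
  equation for \<open>U\<^sub>2'\<close>.\<close>

lemma first_order_coefficient_identity:
  fixes x y c \<gamma> \<kappa> :: real
  assumes "c - y\<^sup>2 \<noteq> 0"
  defines "A \<equiv> c - y\<^sup>2"
  defines "s \<equiv> x + y * \<kappa>"
  defines "G \<equiv> c * s / A"
  defines "y' \<equiv> - x - G"
  defines "a \<equiv> - x * y / A"
  defines "a' \<equiv> (- (y\<^sup>2 + x * y') * A + x * y * ((\<gamma> - 1) * y * G - 2 * y * y')) / A\<^sup>2"
  defines "k \<equiv> (c - x\<^sup>2) / A - a\<^sup>2"
  defines "e \<equiv> ((3 - \<gamma>) * y * s + (\<gamma> + 1) * y * G + (c - 2 * y\<^sup>2) * \<kappa>) / A"
  shows "2 * c - y\<^sup>2 + (\<gamma> - 1) * x * y\<^sup>2 * s / A - (c - x\<^sup>2) = A * (k + a' + a * e)"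
proof -
  have A: "A \<noteq> 0" using assms by simp
  have c: "c = A + y\<^sup>2" by (simp add: A_def)
  show ?thesis
    unfolding a_def a'_def k_def e_def y'_def G_def using A unfolding c s_def
    by (simp add: field_simps power2_eq_square)
qed

locale conical_flow =
  fixes b :: flow
  assumes bg: "background_flow b"
begin

lemma th: "0 < th_m b" "th_m b < th_so b" "th_so b < th_p b" "th_p b < pi / 2"
  and gam: "gam b > 1"
  using bg unfolding background_flow_def by blast+

lemma
  assumes "\<theta> \<in> ang b"
  shows sin_pos: "sin \<theta> > 0" and c2_pos: "c2 b \<theta> > 0" and U1_pos: "U1 b \<theta> > 0"
    and U2_pos: "U2 b \<theta> > 0"
    and c2_Bernoulli: "c2 b \<theta> = (gam b - 1) * (B0 b - 1/2 * ((U1 b \<theta>)\<^sup>2 + (U2 b \<theta>)\<^sup>2))"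
proof -
  have *: "\<forall>\<theta>\<in>ang b. rho b \<theta> > 0 \<and> U1 b \<theta> > 0 \<and> U2 b \<theta> > 0 \<and>
      c2 b \<theta> = (gam b - 1) * (B0 b - 1/2 * ((U1 b \<theta>)\<^sup>2 + (U2 b \<theta>)\<^sup>2))" "A0 b > 0"
    using bg unfolding background_flow_def by blast+
  then show "U1 b \<theta> > 0" "U2 b \<theta> > 0"
    "c2 b \<theta> = (gam b - 1) * (B0 b - 1/2 * ((U1 b \<theta>)\<^sup>2 + (U2 b \<theta>)\<^sup>2))"
    using assms by blast+
  have "rho b \<theta> > 0" using * assms by blast
  then show "c2 b \<theta> > 0" using *(2) gam unfolding c2_def by simp
  have "0 < \<theta>" "\<theta> < pi" using assms th by auto
  then show "sin \<theta> > 0" by (rule sin_gt_zero)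
qed

lemma
  assumes "\<theta> \<in> ang b"
  shows M1_sq: "(M1 b \<theta>)\<^sup>2 = (U1 b \<theta>)\<^sup>2 / c2 b \<theta>" and M2_sq: "(M2 b \<theta>)\<^sup>2 = (U2 b \<theta>)\<^sup>2 / c2 b \<theta>"
  using c2_pos[OF assms] by (simp_all add: M1_def M2_def power_divide)

lemma
  assumes "\<theta> \<in> ang b"
  shows A11_pos: "A11 b \<theta> > 0" and A22_pos: "A22 b \<theta> > 0"
proof -
  have "\<forall>\<theta>\<in>ang b. 1 - (M1 b \<theta>)\<^sup>2 > 0 \<and> 1 - (M2 b \<theta>)\<^sup>2 > 0"
    using bg unfolding background_flow_def by blast
  then have "1 - (M1 b \<theta>)\<^sup>2 > 0" "1 - (M2 b \<theta>)\<^sup>2 > 0" using assms by blast+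
  then show "A11 b \<theta> > 0" "A22 b \<theta> > 0"
    using c2_pos[OF assms] by (simp_all add: M1_sq[OF assms] M2_sq[OF assms] A11_def A22_def)
qed

lemma M2_gap: "\<theta> \<in> ang b \<Longrightarrow> 1 - (M2 b \<theta>)\<^sup>2 = A22 b \<theta> / c2 b \<theta>"
  using c2_pos[of \<theta>] by (simp add: M2_sq A22_def field_simps)

text \<open>The primed functions are the derivatives of the unprimed ones along the background flow, written
  out so that their continuity is visible; \<open>bend\<close> is the quotient in the equation for \<open>U\<^sub>2'\<close>.\<close>

definition src where "src \<theta> = U1 b \<theta> + U2 b \<theta> * cot \<theta>"
definition bend where "bend \<theta> = c2 b \<theta> * src \<theta> / A22 b \<theta>"
definition U2' where "U2' \<theta> = - U1 b \<theta> - bend \<theta>"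
definition c2' where "c2' \<theta> = (gam b - 1) * U2 b \<theta> * bend \<theta>"
definition a where "a \<theta> = A12 b \<theta> / A22 b \<theta>"
definition A22' where "A22' \<theta> = c2' \<theta> - 2 * U2 b \<theta> * U2' \<theta>"
definition a' where
  "a' \<theta> = (- ((U2 b \<theta>)\<^sup>2 + U1 b \<theta> * U2' \<theta>) * A22 b \<theta> - A12 b \<theta> * A22' \<theta>) / (A22 b \<theta>)\<^sup>2"
definition k11' where
  "k11' \<theta> = ((c2' \<theta> - 2 * U1 b \<theta> * U2 b \<theta>) * A22 b \<theta> - A11 b \<theta> * A22' \<theta>) / (A22 b \<theta>)\<^sup>2
     - 2 * a \<theta> * a' \<theta>"

lemma bend_eq:
  assumes "\<theta> \<in> ang b"
  shows "(U1 b \<theta> * sin \<theta> + U2 b \<theta> * cos \<theta>) / ((1 - (M2 b \<theta>)\<^sup>2) * sin \<theta>) = bend \<theta>"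
  unfolding M2_gap[OF assms] bend_def src_def cot_def
  using sin_pos[OF assms] c2_pos[OF assms] A22_pos[OF assms] by (simp add: field_simps)

lemma U1_deriv: "(U1 b has_real_derivative U2 b \<theta>) (at \<theta> within ang b)"
  and U2_deriv: "(U2 b has_real_derivative U2' \<theta>) (at \<theta> within ang b)" if "\<theta> \<in> ang b"
proof -
  have "\<forall>\<theta>\<in>ang b. (U1 b has_real_derivative U2 b \<theta>) (at \<theta> within ang b) \<and>
        (U2 b has_real_derivative
           - U1 b \<theta> - (U1 b \<theta> * sin \<theta> + U2 b \<theta> * cos \<theta>) / ((1 - (M2 b \<theta>)\<^sup>2) * sin \<theta>))
           (at \<theta> within ang b)"
    using bg unfolding background_flow_def by blast
  from bspec[OF this that] show "(U1 b has_real_derivative U2 b \<theta>) (at \<theta> within ang b)"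
    "(U2 b has_real_derivative U2' \<theta>) (at \<theta> within ang b)"
    unfolding bend_eq[OF that] U2'_def by blast+
qed

text \<open>The sound speed is differentiated through Bernoulli's law, because the derivative of the density
  is not given; the product \<open>U\<^sub>1 U\<^sub>2\<close> cancels.\<close>

lemma c2_deriv:
  assumes "\<theta> \<in> ang b"
  shows "(c2 b has_real_derivative c2' \<theta>) (at \<theta> within ang b)"
proof -
  have "((\<lambda>\<theta>. (gam b - 1) * (B0 b - 1/2 * ((U1 b \<theta>)\<^sup>2 + (U2 b \<theta>)\<^sup>2))) has_real_derivative c2' \<theta>)
      (at \<theta> within ang b)"
    by (rule U1_deriv[OF assms] U2_deriv[OF assms] derivative_eq_intros refl)+
      (simp add: c2'_def U2'_def field_simps)
  then show ?thesis
    by (rule has_field_derivative_transform_within[OF _ zero_less_one assms])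
      (simp add: c2_Bernoulli)
qed

lemma A22_deriv: "\<theta> \<in> ang b \<Longrightarrow> (A22 b has_real_derivative A22' \<theta>) (at \<theta> within ang b)"
  unfolding A22_def[abs_def] A22'_def
  by (rule U2_deriv c2_deriv derivative_eq_intros refl | assumption)+ simp

lemma a_deriv:
  assumes "\<theta> \<in> ang b"
  shows "(a has_real_derivative a' \<theta>) (at \<theta> within ang b)"
proof -
  have nz: "A22 b \<theta> \<noteq> 0" using A22_pos[OF assms] by simp
  show ?thesis
    unfolding a_def[abs_def] a'_def A12_def
    by (rule U1_deriv[OF assms] U2_deriv[OF assms] A22_deriv[OF assms] derivative_eq_intros refl | fact)+
      (simp add: power2_eq_square algebra_simps)
qed

lemma k11_eq:
  assumes "\<theta> \<in> ang b"
  shows "k11 b \<theta> = A11 b \<theta> / A22 b \<theta> - (a \<theta>)\<^sup>2"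
proof -
  have "1 - (M1 b \<theta>)\<^sup>2 - (M2 b \<theta>)\<^sup>2 = (c2 b \<theta> - (U1 b \<theta>)\<^sup>2 - (U2 b \<theta>)\<^sup>2) / c2 b \<theta>"
    using c2_pos[OF assms] assms by (simp add: M1_sq M2_sq field_simps)
  then have "k11 b \<theta> = c2 b \<theta> * (c2 b \<theta> - (U1 b \<theta>)\<^sup>2 - (U2 b \<theta>)\<^sup>2) / (A22 b \<theta>)\<^sup>2"
    unfolding k11_def M2_gap[OF assms] using c2_pos[OF assms] A22_pos[OF assms]
    by (simp add: field_simps power2_eq_square)
  also have "\<dots> = (A11 b \<theta> * A22 b \<theta> - (A12 b \<theta>)\<^sup>2) / (A22 b \<theta>)\<^sup>2"
    by (simp add: A11_def A12_def A22_def power2_eq_square algebra_simps)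
  also have "\<dots> = A11 b \<theta> / A22 b \<theta> - (a \<theta>)\<^sup>2"
    using A22_pos[OF assms] by (simp add: a_def power2_eq_square field_simps)
  finally show ?thesis .
qed

lemma k11_deriv:
  assumes "\<theta> \<in> ang b"
  shows "(k11 b has_real_derivative k11' \<theta>) (at \<theta> within ang b)"
proof -
  have "((\<lambda>\<theta>. A11 b \<theta> / A22 b \<theta> - (a \<theta>)\<^sup>2) has_real_derivative k11' \<theta>) (at \<theta> within ang b)"
    using A22_pos[OF assms] assms unfolding A11_def[abs_def] k11'_def
    by (auto intro!: derivative_eq_intros U1_deriv c2_deriv A22_deriv a_deriv
      simp: power2_eq_square algebra_simps)
  then show ?thesis
    by (rule has_field_derivative_transform_within[OF _ zero_less_one assms]) (simp add: k11_eq)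
qed

lemma k2_eq:
  assumes "\<theta> \<in> ang b"
  shows "k2 b \<theta> = ((3 - gam b) * U2 b \<theta> * src \<theta> + (gam b + 1) * U2 b \<theta> * bend \<theta>
     + (c2 b \<theta> - 2 * (U2 b \<theta>)\<^sup>2) * cot \<theta>) / A22 b \<theta>"
  unfolding k2_def e2_def M2_gap[OF assms] bend_def src_def by simp

lemma e1_eq:
  assumes "\<theta> \<in> ang b"
  shows "e1 b \<theta> - A11 b \<theta> = A22 b \<theta> * (k11 b \<theta> + a' \<theta> + a \<theta> * k2 b \<theta>)"
proof -
  have "e1 b \<theta> = 2 * c2 b \<theta> - (U2 b \<theta>)\<^sup>2 + (gam b - 1) * U1 b \<theta> * (M2 b \<theta>)\<^sup>2 *
      ((U1 b \<theta> * sin \<theta> + U2 b \<theta> * cos \<theta>) / ((1 - (M2 b \<theta>)\<^sup>2) * sin \<theta>))"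
    by (simp add: e1_def)
  also have "\<dots> = 2 * c2 b \<theta> - (U2 b \<theta>)\<^sup>2 + (gam b - 1) * U1 b \<theta> * (U2 b \<theta>)\<^sup>2 * src \<theta> / A22 b \<theta>"
    unfolding bend_eq[OF assms] unfolding M2_sq[OF assms] bend_def using c2_pos[OF assms] by simp
  finally show ?thesis
    using first_order_coefficient_identity[of "c2 b \<theta>" "U2 b \<theta>" "gam b" "U1 b \<theta>" "cot \<theta>"]
      A22_pos[OF assms]
    unfolding k11_eq[OF assms] k2_eq[OF assms] a'_def a_def A12_def A22'_def c2'_def U2'_def
      bend_def src_def A11_def A22_def
    by simp
qed

lemma U_cont: "continuous_on (ang b) (U1 b)" "continuous_on (ang b) (U2 b)"
    "continuous_on (ang b) (c2 b)" "continuous_on (ang b) (A22 b)" "continuous_on (ang b) a"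
    "continuous_on (ang b) (k11 b)"
  using DERIV_continuous_on U1_deriv U2_deriv c2_deriv A22_deriv a_deriv k11_deriv by blast+

lemma deriv_cont: "continuous_on (ang b) src" "continuous_on (ang b) bend"
    "continuous_on (ang b) U2'" "continuous_on (ang b) c2'" "continuous_on (ang b) A22'"
    "continuous_on (ang b) a'" "continuous_on (ang b) k11'" "continuous_on (ang b) (k2 b)"
proof -
  have nz: "sin \<theta> \<noteq> 0" "A22 b \<theta> \<noteq> 0" if "\<theta> \<in> ang b" for \<theta>
    using sin_pos[OF that] A22_pos[OF that] by auto
  note intros = continuous_intros U_cont
  have A11: "continuous_on (ang b) (A11 b)" and A12: "continuous_on (ang b) (A12 b)"
    unfolding A11_def A12_def by (intro intros)+
  show src: "continuous_on (ang b) src" unfolding src_def cot_def by (intro intros) (use nz in blast)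
  show bend: "continuous_on (ang b) bend" unfolding bend_def by (intro intros src) (use nz in blast)
  show U2': "continuous_on (ang b) U2'" unfolding U2'_def by (intro intros bend)
  show c2': "continuous_on (ang b) c2'" unfolding c2'_def by (intro intros bend)
  show A22': "continuous_on (ang b) A22'" unfolding A22'_def by (intro intros c2' U2')
  show a': "continuous_on (ang b) a'" unfolding a'_def
    by (intro intros A22' U2' A12) (use nz in simp)
  show "continuous_on (ang b) k11'" unfolding k11'_def
    by (intro intros A22' a' A11 c2') (use nz in simp)
  have "continuous_on (ang b) (\<lambda>\<theta>. ((3 - gam b) * U2 b \<theta> * src \<theta> + (gam b + 1) * U2 b \<theta> * bend \<theta>
     + (c2 b \<theta> - 2 * (U2 b \<theta>)\<^sup>2) * (cos \<theta> / sin \<theta>)) / A22 b \<theta>)"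
    by (intro intros src bend) (use nz in blast)+
  then show "continuous_on (ang b) (k2 b)"
    by (rule continuous_on_eq) (simp add: k2_eq cot_def)
qed

end

section \<open>The multiplier of the background flow\<close>

lemma LBINT_has_real_derivative:
  fixes g :: "real \<Rightarrow> real"
  assumes "continuous_on {x0..x1} g" "c \<in> {x0..x1}" "x \<in> {x0..x1}"
  shows "((\<lambda>x. LBINT y=c..x. g y) has_real_derivative g x) (at x within {x0..x1})"
  using interval_integral_FTC2[of x0 c x1 g x] assms
  by (simp add: has_real_derivative_iff_has_vector_derivative)

lemma LBINT_split:
  fixes g :: "real \<Rightarrow> real"
  assumes g: "continuous_on {x0..x1} g" and c: "c \<in> {x0..x1}" and x: "x \<in> {x0..x1}"
    and y: "y \<in> {x0..x1}"
  shows "(LBINT t=x..y. g t) = (LBINT t=c..y. g t) - (LBINT t=c..x. g t)"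
proof -
  have "interval_lebesgue_integrable lborel (min (ereal c) (min (ereal x) (ereal y)))
      (max (ereal c) (max (ereal x) (ereal y))) g"
    unfolding ereal_min[symmetric] ereal_max[symmetric]
  proof (rule interval_integrable_continuous_on)
    show "continuous_on {min c (min x y)..max c (max x y)} g"
      by (rule continuous_on_subset[OF g]) (use c x y in auto)
  qed auto
  from interval_integral_sum[OF this] show ?thesis by simp
qed

locale weighted_flow = conical_flow +
  fixes thc \<delta>1 \<delta>2 :: real
  assumes thc: "thc \<in> ang b" and adm: "d_admissible b \<delta>1 \<delta>2"
begin

abbreviation "W \<equiv> fexp b thc"
abbreviation "D1 \<equiv> d1 b \<delta>1"
abbreviation "D2 \<equiv> d2 b \<delta>1 \<delta>2"

lemma so: "th_so b \<in> ang b" using th by auto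

lemma W_pos: "W \<theta> > 0" by (simp add: fexp_def)

lemma W_deriv:
  assumes "\<theta> \<in> ang b"
  shows "(W has_real_derivative a \<theta> * W \<theta>) (at \<theta> within ang b)"
proof -
  have "continuous_on (ang b) (\<lambda>\<theta>. A12 b \<theta> / A22 b \<theta>)"
    using U_cont(5) by (simp add: a_def[abs_def])
  note LBINT_has_real_derivative[OF this thc assms, derivative_intros]
  show ?thesis unfolding fexp_def[abs_def] a_def
    by (rule derivative_eq_intros refl LBINT_has_real_derivative thc assms | fact)+ simp
qed

lemma D1_deriv:
  assumes "\<theta> \<in> ang b"
  shows "(D1 has_real_derivative k2 b \<theta> * D1 \<theta>) (at \<theta> within ang b)"
  unfolding d1_def[abs_def]
  by (rule LBINT_has_real_derivative[OF deriv_cont(8) so assms] derivative_eq_intros refl)+ simp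

definition k2_int :: "real \<Rightarrow> real" where "k2_int \<theta> = (LBINT \<tau>=th_so b..\<theta>. k2 b \<tau>)"

lemma k2_int_deriv: "\<theta> \<in> ang b \<Longrightarrow> (k2_int has_real_derivative k2 b \<theta>) (at \<theta> within ang b)"
  unfolding k2_int_def[abs_def] by (rule LBINT_has_real_derivative[OF deriv_cont(8) so])

text \<open>The variation-of-constants form: splitting \<open>\<integral>\<^sub>s\<^sup>\<theta> k\<^sub>2\<close> at \<open>\<theta>\<^sub>s\<^sub>o\<close> takes the dependence on \<open>\<theta>\<close> out
  of the inner integrand, so that the fundamental theorem of calculus applies.\<close>

lemma D2_eq:
  assumes "\<theta> \<in> ang b"
  shows "D2 \<theta> = exp (2 * k2_int \<theta>) *
    (\<delta>2 - 2 * dstar b \<delta>1 * (LBINT s=th_so b..\<theta>. exp (- 2 * k2_int s)))"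
proof -
  have "(LBINT s=th_so b..\<theta>. exp (2 * (LBINT \<tau>=s..\<theta>. k2 b \<tau>))) =
    (LBINT s=th_so b..\<theta>. exp (2 * k2_int \<theta>) * exp (- 2 * k2_int s))"
  proof (rule interval_integral_cong)
    fix s assume "s \<in> einterval (min (ereal (th_so b)) (ereal \<theta>)) (max (ereal (th_so b)) (ereal \<theta>))"
    then have s: "s \<in> ang b"
      using assms so by (auto simp: einterval_def min_def max_def split: if_splits)
    show "exp (2 * (LBINT \<tau>=s..\<theta>. k2 b \<tau>)) = exp (2 * k2_int \<theta>) * exp (- 2 * k2_int s)"
      unfolding LBINT_split[OF deriv_cont(8) so s assms] k2_int_def
      by (simp add: exp_add[symmetric] algebra_simps)
  qed
  then show ?thesis by (simp add: d2_def k2_int_def algebra_simps)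
qed

lemma D2_deriv:
  assumes "\<theta> \<in> ang b"
  shows "(D2 has_real_derivative 2 * k2 b \<theta> * D2 \<theta> - 2 * dstar b \<delta>1) (at \<theta> within ang b)"
proof -
  have "continuous_on (ang b) k2_int" by (rule DERIV_continuous_on[OF k2_int_deriv])
  then have cont: "continuous_on (ang b) (\<lambda>s. exp (- 2 * k2_int s))" by (intro continuous_intros)
  have e: "exp (2 * k2_int \<theta>) * exp (- 2 * k2_int \<theta>) = 1" by (simp add: exp_add[symmetric])
  have "((\<lambda>\<theta>. exp (2 * k2_int \<theta>) * (\<delta>2 - 2 * dstar b \<delta>1 * (LBINT s=th_so b..\<theta>. exp (- 2 * k2_int s))))
      has_real_derivative 2 * k2 b \<theta> * D2 \<theta> - 2 * dstar b \<delta>1 * (exp (2 * k2_int \<theta>) * exp (- 2 * k2_int \<theta>)))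
      (at \<theta> within ang b)"
    unfolding D2_eq[OF assms]
    by (rule k2_int_deriv[OF assms] LBINT_has_real_derivative[OF cont so assms] derivative_eq_intros refl)+
      (simp add: algebra_simps)
  then show ?thesis unfolding e mult_1_right
    by (rule has_field_derivative_transform_within[OF _ zero_less_one assms]) (simp add: D2_eq)
qed

lemma D1_pos: "D1 \<theta> > 0" and D2_pos: "\<theta> \<in> ang b \<Longrightarrow> D2 \<theta> > 0"
  using adm by (auto simp: d_admissible_def d1_def)

text \<open>Both entries of the maximum \<open>d\<^sub>*\<close> are used: \<open>d\<^sub>1 \<le> d\<^sub>*\<close> gives \<open>d\<^sub>* - d\<^sub>1 / 2 \<ge> d\<^sub>* / 2\<close>, and \<open>d\<^sub>* \<ge> 4\<close>.\<close>

lemma dstar_bound: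
  assumes "\<theta> \<in> ang b"
  shows "dstar b \<delta>1 - D1 \<theta> / 2 \<ge> 2"
proof -
  have "continuous_on (ang b) D1" by (rule DERIV_continuous_on[OF D1_deriv])
  then have "bounded (D1 ` ang b)" by (intro compact_imp_bounded compact_continuous_image) auto
  then have "bdd_above ((\<lambda>\<theta>. \<bar>D1 \<theta>\<bar>) ` ang b)"
    by (auto simp: bounded_iff bdd_above_def)
  then have "\<bar>D1 \<theta>\<bar> \<le> (SUP \<theta>\<in>ang b. \<bar>D1 \<theta>\<bar>)" by (rule cSUP_upper[OF assms])
  then show ?thesis by (auto simp: dstar_def)
qed

definition \<kappa>' where
  "\<kappa>' \<theta> = k11' \<theta> * D2 \<theta> + k11 b \<theta> * (2 * k2 b \<theta> * D2 \<theta> - 2 * dstar b \<delta>1)"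

lemma \<kappa>_deriv:
  assumes "\<theta> \<in> ang b"
  shows "((\<lambda>\<theta>. k11 b \<theta> * D2 \<theta>) has_real_derivative \<kappa>' \<theta>) (at \<theta> within ang b)"
  by (rule k11_deriv[OF assms] D2_deriv[OF assms] derivative_eq_intros refl)+
    (simp add: \<kappa>'_def)

lemma vector_derivative_ang:
  assumes "\<theta> \<in> ang b" "(g has_real_derivative D) (at \<theta> within ang b)"
  shows "vector_derivative g (at \<theta> within ang b) = D"
  using vector_derivative_within_cbox[of "th_m b" "th_p b" \<theta> g D] th assms
  by (simp add: has_real_derivative_iff_has_vector_derivative)

lemma \<kappa>_coercive:
  assumes "\<theta> \<in> ang b"
  shows "(\<kappa>' \<theta> - k11 b \<theta> * D1 \<theta>) / 2 \<ge> 2"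
proof -
  have "1/2 * (vector_derivative (\<lambda>t. k11 b t * D2 t) (at \<theta> within ang b) - k11 b \<theta> * D1 \<theta>) \<ge> 2"
    using adm assms unfolding d_admissible_def by blast
  then show ?thesis unfolding vector_derivative_ang[OF assms \<kappa>_deriv[OF assms]] by simp
qed

lemma a_neg: "\<theta> \<in> ang b \<Longrightarrow> a \<theta> < 0"
  using U1_pos[of \<theta>] U2_pos[of \<theta>] A22_pos[of \<theta>] by (simp add: a_def A12_def)

lemma n_pos: "\<theta> \<in> ang b \<Longrightarrow> D1 \<theta> - a \<theta> * D2 \<theta> > 0"
  using D1_pos[of \<theta>] mult_neg_pos[OF a_neg D2_pos] by fastforce

lemma l1_eq:
  assumes "\<theta> \<in> ang b"
  shows "l1 b thc \<delta>1 \<delta>2 \<theta> = (a \<theta> * D2 \<theta> - D1 \<theta>) / (W \<theta> * A22 b \<theta>)"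
  using W_pos[of \<theta>] by (simp add: l1_def vector_derivative_ang[OF assms W_deriv[OF assms]])

lemma obl_eq:
  assumes "\<theta> \<in> ang b"
  shows "obl b thc \<delta>1 \<delta>2 \<theta> = D2 \<theta> / (a \<theta> * D2 \<theta> - D1 \<theta>)"
  using W_pos[of \<theta>] A22_pos[OF assms] by (simp add: obl_def l1_eq[OF assms] l2_def)

text \<open>Substituting \<open>d\<^sub>1 = n + a d\<^sub>2\<close> completes the square: \<open>n\<^sup>2 + 2 a d\<^sub>2 n + (k + a\<^sup>2) d\<^sub>2\<^sup>2 = d\<^sub>1\<^sup>2 + k d\<^sub>2\<^sup>2\<close>.
  Thus \<open>K\<^sub>4 > 0\<close> means that, on the supersonic side, \<open>- k\<close> stays below \<open>(d\<^sub>1 / d\<^sub>2)\<^sup>2\<close>.\<close>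

lemma K4_eq:
  assumes "\<theta> \<in> ang b"
  shows "K4 b thc \<delta>1 \<delta>2 \<theta> = ((D1 \<theta>)\<^sup>2 + k11 b \<theta> * (D2 \<theta>)\<^sup>2) / (W \<theta> * (D1 \<theta> - a \<theta> * D2 \<theta>))"
proof -
  define N where "N = D1 \<theta> - a \<theta> * D2 \<theta>"
  have N: "N \<noteq> 0" and nz: "W \<theta> \<noteq> 0" "A22 b \<theta> \<noteq> 0"
    using n_pos[OF assms] W_pos[of \<theta>] A22_pos[OF assms] by (auto simp: N_def)
  have D1: "D1 \<theta> = N + a \<theta> * D2 \<theta>" and l1: "l1 b thc \<delta>1 \<delta>2 \<theta> = - N / (W \<theta> * A22 b \<theta>)"
    by (simp_all add: N_def l1_eq[OF assms])
  have A12: "A12 b \<theta> = a \<theta> * A22 b \<theta>" and A11: "A11 b \<theta> = (k11 b \<theta> + (a \<theta>)\<^sup>2) * A22 b \<theta>"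
    using nz by (simp_all add: k11_eq[OF assms] a_def)
  show ?thesis
    unfolding K4_def l2_def l1 A12 A11 N_def[symmetric] unfolding D1 using N nz
    by (simp add: field_simps power2_eq_square)
qed

lemma multiplier_flow:
  assumes t: "th_m b \<le> t0" "t0 < t1" "t1 \<le> th_p b"
    and K4: "\<forall>\<theta>\<in>{t0..t1}. K4 b thc \<delta>1 \<delta>2 \<theta> > 0"
  shows "multiplier t0 t1 a a' (k11 b) \<kappa>' (k2 b) D1 D2 W (A22 b) (dstar b \<delta>1)"
proof -
  have sub: "{t0..t1} \<subseteq> ang b" using t by auto
  then have in_ang: "\<theta> \<in> ang b" if "\<theta> \<in> {t0..t1}" for \<theta> using that by blast
  have "continuous_on (ang b) D2" by (rule DERIV_continuous_on[OF D2_deriv])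
  then have \<kappa>'_cont: "continuous_on (ang b) \<kappa>'"
    unfolding \<kappa>'_def by (intro continuous_intros deriv_cont U_cont)
  have J: "(D1 \<theta>)\<^sup>2 + k11 b \<theta> * (D2 \<theta>)\<^sup>2 > 0" if "\<theta> \<in> {t0..t1}" for \<theta>
  proof -
    have "0 < W \<theta> * (D1 \<theta> - a \<theta> * D2 \<theta>)" using W_pos n_pos in_ang that by simp
    moreover have "0 < K4 b thc \<delta>1 \<delta>2 \<theta>" using K4 that by blast
    ultimately show ?thesis
      by (simp only: K4_eq[OF in_ang[OF that]] pos_less_divide_eq mult_zero_left)
  qed
  have E: "k11 b \<theta> + (a \<theta>)\<^sup>2 > 0" if "\<theta> \<in> ang b" for \<theta>
    using A11_pos[OF that] A22_pos[OF that] by (simp add: k11_eq[OF that])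
  show ?thesis
    by unfold_locales
      (rule t(2) W_pos J | assumption
      | (rule DERIV_subset[OF _ sub], rule a_deriv \<kappa>_deriv D1_deriv D2_deriv W_deriv, erule in_ang)
      | (rule continuous_on_subset[OF _ sub], rule deriv_cont U_cont \<kappa>'_cont)
      | (rule A22_pos D2_pos n_pos E \<kappa>_coercive dstar_bound, erule in_ang))+
qed

end

section \<open>The boundary value problem\<close>

lemma
  fixes \<Psi> :: "real \<times> real \<Rightarrow> real"
  assumes "\<Psi> differentiable_on R \<times> T" and "x \<in> R" "y \<in> T"
  shows pd_fst: "((\<lambda>x. \<Psi> (x, y)) has_real_derivative pd (R \<times> T) (1, 0) \<Psi> (x, y)) (at x within R)"
    and pd_snd: "((\<lambda>y. \<Psi> (x, y)) has_real_derivative pd (R \<times> T) (0, 1) \<Psi> (x, y)) (at y within T)"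
proof -
  let ?D = "frechet_derivative \<Psi> (at (x, y) within R \<times> T)"
  have D: "(\<Psi> has_derivative ?D) (at (x, y) within R \<times> T)"
    using assms by (simp add: differentiable_on_def frechet_derivative_works)
  then have lin: "linear ?D" by (rule has_derivative_linear)
  have "((\<lambda>x. \<Psi> (x, y)) has_derivative (\<lambda>h. ?D (h, 0))) (at x within R)"
    by (rule has_derivative_in_compose[where f = "\<lambda>x. (x, y)" and g = \<Psi>,
          OF has_derivative_Pair[OF has_derivative_ident has_derivative_const] has_derivative_subset[OF D]])
      (use assms in auto)
  moreover have "(\<lambda>h. ?D (h, 0)) = (*) (?D (1, 0))"
  proof
    show "?D (h, 0) = ?D (1, 0) * h" for h
      using linear_scale[OF lin, of h "(1, 0)"] by (simp add: mult.commute)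
  qed
  ultimately show "((\<lambda>x. \<Psi> (x, y)) has_real_derivative pd (R \<times> T) (1, 0) \<Psi> (x, y)) (at x within R)"
    unfolding has_field_derivative_def pd_def by simp
  have "((\<lambda>y. \<Psi> (x, y)) has_derivative (\<lambda>h. ?D (0, h))) (at y within T)"
    by (rule has_derivative_in_compose[where f = "\<lambda>y. (x, y)" and g = \<Psi>,
          OF has_derivative_Pair[OF has_derivative_const has_derivative_ident] has_derivative_subset[OF D]])
      (use assms in auto)
  moreover have "(\<lambda>h. ?D (0, h)) = (*) (?D (0, 1))"
  proof
    show "?D (0, h) = ?D (0, 1) * h" for h
      using linear_scale[OF lin, of h "(0, 1)"] by (simp add: mult.commute)
  qed
  ultimately show "((\<lambda>y. \<Psi> (x, y)) has_real_derivative pd (R \<times> T) (0, 1) \<Psi> (x, y)) (at y within T)"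
    unfolding has_field_derivative_def pd_def by simp
qed

lemma smooth_upto_differentiable: "smooth_upto S \<Psi> \<Longrightarrow> \<Psi> differentiable_on S"
  using Ck_on.simps(2)[of 0] unfolding smooth_upto_def by blast

lemma smooth_upto_second_order:
  fixes \<Psi> :: "real \<times> real \<Rightarrow> real"
  assumes "smooth_upto S \<Psi>" and "e \<in> {(1, 0), (0, 1)}" "e' \<in> {(1, 0), (0, 1)}"
  shows "\<Psi> differentiable_on S" "pd S e \<Psi> differentiable_on S"
    "continuous_on S (pd S e' (pd S e \<Psi>))"
proof -
  have "e \<in> Basis" "e' \<in> Basis" using assms by (auto simp: Basis_prod_def)
  moreover have "Ck_on (Suc (Suc 0)) S \<Psi>" using assms(1) unfolding smooth_upto_def by blast
  ultimately show "\<Psi> differentiable_on S" "pd S e \<Psi> differentiable_on S"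
    "continuous_on S (pd S e' (pd S e \<Psi>))" by auto
qed

text \<open>The derivative \<open>\<partial>\<^sub>\<theta>u\<close> is recorded as \<open>r \<partial>\<^sub>r\<partial>\<^sub>\<theta>\<Psi>\<close>, the order of differentiation in which the
  equation is stated; this is where the symmetry of mixed derivatives enters.\<close>

lemma log_gradient_potential:
  fixes \<Psi> :: "real \<times> real \<Rightarrow> real"
  assumes r: "r0 < r1" and t: "t0 < t1" and smooth: "smooth_upto ({r0..r1} \<times> {t0..t1}) \<Psi>"
  defines "S \<equiv> {r0..r1} \<times> {t0..t1}"
  defines "P \<equiv> pd S (1, 0) \<Psi>" and "Q \<equiv> pd S (0, 1) \<Psi>"
  shows "log_gradient {r0..r1} {t0..t1} (\<lambda>z. fst z * P z) Q
    (\<lambda>z. P z + fst z * pd S (1, 0) P z) (\<lambda>z. fst z * pd S (1, 0) Q z) (pd S (1, 0) Q) (pd S (0, 1) Q)"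
proof -
  note C2 = smooth_upto_second_order[OF smooth, folded S_def]
  have diff: "\<Psi> differentiable_on S" "P differentiable_on S" "Q differentiable_on S"
    using C2 unfolding P_def Q_def by blast+
  have cont: "continuous_on S P" "continuous_on S Q" "continuous_on S (pd S (1, 0) P)"
    "continuous_on S (pd S (0, 1) P)" "continuous_on S (pd S (1, 0) Q)" "continuous_on S (pd S (0, 1) Q)"
    using diff C2(3) unfolding P_def Q_def by (auto intro: differentiable_imp_continuous_on)
  note pds = pd_fst[of _ "{r0..r1}" "{t0..t1}", folded S_def] pd_snd[of _ "{r0..r1}" "{t0..t1}", folded S_def]
  note \<Psi>_derivs = pds(1)[OF diff(1), folded P_def] pds(2)[OF diff(1), folded Q_def]
    pds(2)[OF diff(2)] pds(1)[OF diff(3)]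
  have mixed: "pd S (1, 0) Q (x, y) = pd S (0, 1) P (x, y)" if "x \<in> {r0..r1}" "y \<in> {t0..t1}" for x y
    using mixed_partials_rectangle[OF r t \<Psi>_derivs _ _ that, folded S_def] cont(1,4) by blast
  show ?thesis
    unfolding log_gradient_def
  proof (intro conjI ballI)
    fix x y assume xy: "x \<in> {r0..r1}" "y \<in> {t0..t1}"
    show "((\<lambda>x. fst (x, y) * P (x, y)) has_real_derivative
        P (x, y) + fst (x, y) * pd S (1, 0) P (x, y)) (at x within {r0..r1})"
      unfolding fst_conv
      by (rule pds(1)[OF diff(2) xy] derivative_eq_intros refl)+ simp
    show "((\<lambda>y. fst (x, y) * P (x, y)) has_real_derivative
        fst (x, y) * pd S (1, 0) Q (x, y)) (at y within {t0..t1})"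
      unfolding fst_conv mixed[OF xy]
      by (rule pds(2)[OF diff(2) xy] derivative_eq_intros refl)+ simp
    show "((\<lambda>x. Q (x, y)) has_real_derivative pd S (1, 0) Q (x, y)) (at x within {r0..r1})"
      "((\<lambda>y. Q (x, y)) has_real_derivative pd S (0, 1) Q (x, y)) (at y within {t0..t1})"
      using pds[OF diff(3) xy] by blast+
  next
    fix g assume "g \<in> {\<lambda>z. fst z * P z, Q, \<lambda>z. P z + fst z * pd S (1, 0) P z,
      \<lambda>z. fst z * pd S (1, 0) Q z, pd S (1, 0) Q, pd S (0, 1) Q}"
    then show "continuous_on ({r0..r1} \<times> {t0..t1}) g"
      using cont unfolding S_def[symmetric] by (auto intro!: continuous_intros)
  qed simp
qed

lemma log_gradient_diff:
  assumes "log_gradient R T u v ur u\<theta> vr v\<theta>" "log_gradient R T x y xr x\<theta> yr y\<theta>"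
  shows "log_gradient R T (\<lambda>z. u z - x z) (\<lambda>z. v z - y z) (\<lambda>z. ur z - xr z)
    (\<lambda>z. u\<theta> z - x\<theta> z) (\<lambda>z. vr z - yr z) (\<lambda>z. v\<theta> z - y\<theta> z)"
  unfolding log_gradient_def
proof (intro conjI ballI)
  fix g assume "g \<in> {\<lambda>z. u z - x z, \<lambda>z. v z - y z, \<lambda>z. ur z - xr z, \<lambda>z. u\<theta> z - x\<theta> z,
    \<lambda>z. vr z - yr z, \<lambda>z. v\<theta> z - y\<theta> z}"
  then show "continuous_on (R \<times> T) g"
    by (auto intro!: continuous_on_diff log_gradient_cont[OF assms(1)] log_gradient_cont[OF assms(2)])
next
  fix r \<theta> assume "r \<in> R" "\<theta> \<in> T"
  then show "u\<theta> (r, \<theta>) - x\<theta> (r, \<theta>) = r * (vr (r, \<theta>) - yr (r, \<theta>))"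
    using log_gradientD(5)[OF assms(1)] log_gradientD(5)[OF assms(2)] by (simp add: right_diff_distrib)
qed (rule DERIV_diff; rule log_gradientD[OF assms(1)] log_gradientD[OF assms(2)]; assumption)+

locale bvp_setting = weighted_flow +
  fixes t0 t1 :: real
  assumes t: "th_m b \<le> t0" "t0 < t1" "t1 \<le> th_p b"
    and K4_pos: "\<forall>\<theta>\<in>{t0..t1}. K4 b thc \<delta>1 \<delta>2 \<theta> > 0"

sublocale bvp_setting \<subseteq> mult: multiplier t0 t1 a a' "k11 b" \<kappa>' "k2 b" "d1 b \<delta>1" "d2 b \<delta>1 \<delta>2"
    "fexp b thc" "A22 b" "dstar b \<delta>1"
  by (rule multiplier_flow) (fact t K4_pos)+

context bvp_setting
begin

abbreviation (input) "S r0 r1 \<equiv> {r0..r1} \<times> {t0..t1}"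
abbreviation "ob \<equiv> obl b thc \<delta>1 \<delta>2"

lemma m_obl: "\<theta> \<in> {t0..t1} \<Longrightarrow> mult.m \<theta> = ob \<theta>"
  using t by (subst obl_eq) (auto simp: mult.m_def)

text \<open>The boundary value problem as a first-order system. The data are compared on the open rectangle
  and the open sides only, because outside of them nothing is known about \<open>F\<close>, \<open>g\<^sub>0\<close>, \<open>g\<^sub>1\<close>, \<open>h\<^sub>0\<close>,
  \<open>h\<^sub>1\<close>.\<close>

definition system where
  "system r0 r1 u v ur u\<theta> vr v\<theta> F g0 g1 h0 h1 \<longleftrightarrow>
    log_gradient {r0..r1} {t0..t1} u v ur u\<theta> vr v\<theta> \<and>
    (\<forall>r\<in>{r0<..<r1}. \<forall>\<theta>\<in>{t0<..<t1}.
      A22 b \<theta> * mult.oper u v ur u\<theta> v\<theta> (r, \<theta>) = r\<^sup>2 * F r \<theta>) \<and>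
    (\<forall>\<theta>\<in>{t0<..<t1}. v (r0, \<theta>) = r0 * g0 \<theta> \<and> u (r1, \<theta>) + mult.m \<theta> * v (r1, \<theta>) = r1 * g1 \<theta>) \<and>
    (\<forall>r\<in>{r0<..<r1}. u (r, t0) + mult.m t0 * v (r, t0) = r * h0 r \<and> u (r, t1) = r * h1 r)"

lemma oper_solution:
  assumes "\<theta> \<in> {t0..t1}" and r: "r > 0"
    and u: "u (r, \<theta>) = r * p" "v (r, \<theta>) = q" "ur (r, \<theta>) = p + r * prr" "u\<theta> (r, \<theta>) = r * prt"
      "v\<theta> (r, \<theta>) = qtt"
  shows "A22 b \<theta> * mult.oper u v ur u\<theta> v\<theta> (r, \<theta>) = r\<^sup>2 *
    (A11 b \<theta> * prr + 2 * A12 b \<theta> / r * prt + A22 b \<theta> / r\<^sup>2 * qtt + e1 b \<theta> / r * p + e2 b \<theta> / r\<^sup>2 * q)"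
proof -
  have \<theta>: "\<theta> \<in> ang b" using assms t by auto
  have nz: "A22 b \<theta> \<noteq> 0" using A22_pos[OF \<theta>] by simp
  have A: "A12 b \<theta> = a \<theta> * A22 b \<theta>" "A11 b \<theta> = (k11 b \<theta> + (a \<theta>)\<^sup>2) * A22 b \<theta>"
    "e2 b \<theta> = k2 b \<theta> * A22 b \<theta>"
    using nz by (simp_all add: k11_eq[OF \<theta>] a_def k2_def)
  have e1: "e1 b \<theta> = A11 b \<theta> + A22 b \<theta> * (k11 b \<theta> + a' \<theta> + a \<theta> * k2 b \<theta>)"
    using e1_eq[OF \<theta>] by simp
  show ?thesis
    unfolding mult.oper_def Let_def fst_conv snd_conv u e1 A using r
    by (simp add: field_simps power2_eq_square)
qed

lemma bvp_solution_system:
  assumes r: "0 < r0" "r0 < r1" and sol: "bvp_solution b ob t0 t1 r0 r1 F g0 g1 h0 h1 \<Psi>"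
  shows "\<exists>ur u\<theta> vr v\<theta>. system r0 r1 (\<lambda>z. fst z * pd (S r0 r1) (1, 0) \<Psi> z) (pd (S r0 r1) (0, 1) \<Psi>)
    ur u\<theta> vr v\<theta> F g0 g1 h0 h1"
proof -
  define P Q where "P = pd (S r0 r1) (1, 0) \<Psi>" and "Q = pd (S r0 r1) (0, 1) \<Psi>"
  have smooth: "smooth_upto (S r0 r1) \<Psi>" using sol by (simp add: bvp_solution_def Let_def)
  note grad = log_gradient_potential[OF r(2) t(2) smooth, folded P_def Q_def]
  have "system r0 r1 (\<lambda>z. fst z * P z) Q (\<lambda>z. P z + fst z * pd (S r0 r1) (1, 0) P z)
    (\<lambda>z. fst z * pd (S r0 r1) (1, 0) Q z) (pd (S r0 r1) (1, 0) Q) (pd (S r0 r1) (0, 1) Q) F g0 g1 h0 h1"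
    unfolding system_def
  proof (intro conjI ballI grad)
    fix x \<theta> assume x: "x \<in> {r0<..<r1}" and \<theta>: "\<theta> \<in> {t0<..<t1}"
    have "A22 b \<theta> * mult.oper (\<lambda>z. fst z * P z) Q (\<lambda>z. P z + fst z * pd (S r0 r1) (1, 0) P z)
      (\<lambda>z. fst z * pd (S r0 r1) (1, 0) Q z) (pd (S r0 r1) (0, 1) Q) (x, \<theta>) = x\<^sup>2 *
      (A11 b \<theta> * pd (S r0 r1) (1, 0) P (x, \<theta>) + 2 * A12 b \<theta> / x * pd (S r0 r1) (1, 0) Q (x, \<theta>)
        + A22 b \<theta> / x\<^sup>2 * pd (S r0 r1) (0, 1) Q (x, \<theta>) + e1 b \<theta> / x * P (x, \<theta>)
        + e2 b \<theta> / x\<^sup>2 * Q (x, \<theta>))"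
      by (rule oper_solution) (use x \<theta> r in auto)
    also have "\<dots> = x\<^sup>2 * F x \<theta>"
      using sol x \<theta> by (simp add: bvp_solution_def Let_def P_def Q_def)
    finally show "A22 b \<theta> * mult.oper (\<lambda>z. fst z * P z) Q
      (\<lambda>z. P z + fst z * pd (S r0 r1) (1, 0) P z)
      (\<lambda>z. fst z * pd (S r0 r1) (1, 0) Q z) (pd (S r0 r1) (0, 1) Q) (x, \<theta>) = x\<^sup>2 * F x \<theta>" .
  next
    fix \<theta> assume \<theta>: "\<theta> \<in> {t0<..<t1}"
    have "1 / r0 * Q (r0, \<theta>) = g0 \<theta>" "P (r1, \<theta>) + ob \<theta> * (1 / r1) * Q (r1, \<theta>) = g1 \<theta>"
      using sol \<theta> by (simp_all add: bvp_solution_def Let_def P_def Q_def)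
    then show "Q (r0, \<theta>) = r0 * g0 \<theta>"
      "fst (r1, \<theta>) * P (r1, \<theta>) + mult.m \<theta> * Q (r1, \<theta>) = r1 * g1 \<theta>"
      using r \<theta> m_obl[of \<theta>] by (auto simp: field_simps)
  next
    fix x assume x: "x \<in> {r0<..<r1}"
    have "P (x, t0) + ob t0 * (1 / x) * Q (x, t0) = h0 x" "P (x, t1) = h1 x"
      using sol x by (simp_all add: bvp_solution_def Let_def P_def Q_def)
    then show "fst (x, t0) * P (x, t0) + mult.m t0 * Q (x, t0) = x * h0 x"
      "fst (x, t1) * P (x, t1) = x * h1 x"
      using r x t m_obl[of t0] by (auto simp: field_simps)
  qed
  then show ?thesis unfolding P_def Q_def by blast
qed

lemma system_diff:
  assumes "system r0 r1 u v ur u\<theta> vr v\<theta> F g0 g1 h0 h1" "system r0 r1 x y xr x\<theta> yr y\<theta> F g0 g1 h0 h1"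
  shows "system r0 r1 (\<lambda>z. u z - x z) (\<lambda>z. v z - y z) (\<lambda>z. ur z - xr z)
    (\<lambda>z. u\<theta> z - x\<theta> z) (\<lambda>z. vr z - yr z) (\<lambda>z. v\<theta> z - y\<theta> z)
    (\<lambda>_ _. 0) (\<lambda>_. 0) (\<lambda>_. 0) (\<lambda>_. 0) (\<lambda>_. 0)"
proof -
  have op: "mult.oper (\<lambda>z. u z - x z) (\<lambda>z. v z - y z) (\<lambda>z. ur z - xr z)
      (\<lambda>z. u\<theta> z - x\<theta> z) (\<lambda>z. v\<theta> z - y\<theta> z) z =
    mult.oper u v ur u\<theta> v\<theta> z - mult.oper x y xr x\<theta> y\<theta> z" for z
    by (simp add: mult.oper_def Let_def algebra_simps)
  show ?thesis
    using assms log_gradient_diff[of _ _ u v ur u\<theta> vr v\<theta> x y xr x\<theta> yr y\<theta>]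
    unfolding system_def op by (auto simp: algebra_simps)
qed

text \<open>Corners and end points are null sets, so the data may be replaced by the continuous traces of
  the solution. In particular all integrals of the data exist.\<close>

lemma data_size_eq:
  assumes "system r0 r1 u v ur u\<theta> vr v\<theta> F g0 g1 h0 h1"
  shows "integral (S r0 r1) (\<lambda>z. (A22 b (snd z) * mult.oper u v ur u\<theta> v\<theta> z)\<^sup>2)
      + integral {t0..t1} (\<lambda>\<theta>. r1 * (u (r1, \<theta>) + mult.m \<theta> * v (r1, \<theta>))\<^sup>2 + r0 * (v (r0, \<theta>))\<^sup>2)
      + integral {r0..r1} (\<lambda>r. (u (r, t0) + mult.m t0 * v (r, t0))\<^sup>2 + (u (r, t1))\<^sup>2)
    = data_size t0 t1 r0 r1 F g0 g1 h0 h1"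
proof -
  have interior: "(A22 b \<theta> * mult.oper u v ur u\<theta> v\<theta> (r, \<theta>))\<^sup>2 = r ^ 4 * (F r \<theta>)\<^sup>2"
    if "r \<in> {r0<..<r1}" "\<theta> \<in> {t0<..<t1}" for r \<theta>
  proof -
    have "A22 b \<theta> * mult.oper u v ur u\<theta> v\<theta> (r, \<theta>) = r\<^sup>2 * F r \<theta>"
      using assms that unfolding system_def by blast
    then show ?thesis by (simp add: power_mult_distrib flip: power_mult)
  qed
  have 1: "integral (S r0 r1) (\<lambda>z. (A22 b (snd z) * mult.oper u v ur u\<theta> v\<theta> z)\<^sup>2) =
      integral ({r0<..<r1} \<times> {t0<..<t1}) (\<lambda>(r, \<theta>). r ^ 4 * (F r \<theta>)\<^sup>2)"
    unfolding integral_rectangle_interior[symmetric]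
    by (intro Henstock_Kurzweil_Integration.integral_cong) (clarsimp simp: interior)
  have 2: "integral {t0..t1} (\<lambda>\<theta>. r1 * (u (r1, \<theta>) + mult.m \<theta> * v (r1, \<theta>))\<^sup>2 + r0 * (v (r0, \<theta>))\<^sup>2) =
      integral {t0..t1} (\<lambda>\<theta>. r1 ^ 3 * (g1 \<theta>)\<^sup>2 + r0 ^ 3 * (g0 \<theta>)\<^sup>2)"
    using assms unfolding system_def
    by (intro integral_interval_cong_interior) (simp add: power_mult_distrib power2_eq_square power3_eq_cube)
  have 3: "integral {r0..r1} (\<lambda>r. (u (r, t0) + mult.m t0 * v (r, t0))\<^sup>2 + (u (r, t1))\<^sup>2) =
      integral {r0..r1} (\<lambda>r. r\<^sup>2 * ((h0 r)\<^sup>2 + (h1 r)\<^sup>2))"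
    using assms unfolding system_def
    by (intro integral_interval_cong_interior) (simp add: power_mult_distrib distrib_left)
  show ?thesis unfolding data_size_def 1 2 3 ..
qed

lemma energy_eq:
  fixes \<Psi> :: "real \<times> real \<Rightarrow> real"
  assumes r: "0 < r0" "r0 < r1"
  defines "P \<equiv> pd (S r0 r1) (1, 0) \<Psi>" and "Q \<equiv> pd (S r0 r1) (0, 1) \<Psi>"
  defines "u \<equiv> \<lambda>z. fst z * P z"
  shows "energy ob t0 t1 r0 r1 \<Psi> = integral (S r0 r1) (\<lambda>z. (u z)\<^sup>2 + (Q z)\<^sup>2)
      + integral {t0..t1} (\<lambda>\<theta>. r0 * (u (r0, \<theta>) + mult.m \<theta> * Q (r0, \<theta>))\<^sup>2 + r1 * (Q (r1, \<theta>))\<^sup>2)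
      + integral {r0..r1} (\<lambda>r. (u (r, t1) + mult.m t1 * Q (r, t1))\<^sup>2 + (u (r, t0))\<^sup>2)"
proof -
  have 1: "integral ({r0<..<r1} \<times> {t0<..<t1}) (\<lambda>(r, \<theta>). r\<^sup>2 * ((P (r, \<theta>))\<^sup>2 + (1 / r * Q (r, \<theta>))\<^sup>2)) =
      integral (S r0 r1) (\<lambda>z. (u z)\<^sup>2 + (Q z)\<^sup>2)"
    unfolding integral_rectangle_interior[symmetric] using r
    by (intro Henstock_Kurzweil_Integration.integral_cong)
      (auto simp: u_def power_mult_distrib power_divide distrib_left)
  have 2: "integral {t0..t1} (\<lambda>\<theta>. r0 ^ 3 * (P (r0, \<theta>) + ob \<theta> * (1 / r0) * Q (r0, \<theta>))\<^sup>2 + r1 * (Q (r1, \<theta>))\<^sup>2) =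
      integral {t0..t1} (\<lambda>\<theta>. r0 * (u (r0, \<theta>) + mult.m \<theta> * Q (r0, \<theta>))\<^sup>2 + r1 * (Q (r1, \<theta>))\<^sup>2)"
    using r by (intro integral_interval_cong_interior)
      (simp add: m_obl u_def field_simps power2_eq_square power3_eq_cube)
  have 3: "integral {r0..r1} (\<lambda>x. x\<^sup>2 * (P (x, t1) + ob t1 * (1 / x) * Q (x, t1))\<^sup>2 + x\<^sup>2 * (P (x, t0))\<^sup>2) =
      integral {r0..r1} (\<lambda>x. (u (x, t1) + mult.m t1 * Q (x, t1))\<^sup>2 + (u (x, t0))\<^sup>2)"
    using r t by (intro integral_interval_cong_interior)
      (simp add: m_obl u_def field_simps power2_eq_square)
  show ?thesis unfolding energy_def Let_def P_def[symmetric] Q_def[symmetric] 1 2 3 ..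
qed

theorem bvp_energy_estimate:
  "\<exists>C>0. \<forall>r0 r1 F g0 g1 h0 h1 \<Psi>.
     0 < r0 \<and> r0 < r1 \<and> bvp_solution b ob t0 t1 r0 r1 F g0 g1 h0 h1 \<Psi> \<longrightarrow>
     energy ob t0 t1 r0 r1 \<Psi> \<le> C * data_size t0 t1 r0 r1 F g0 g1 h0 h1"
proof -
  obtain C where C: "C > 0" and est: "\<And>r0 r1 u v ur u\<theta> vr v\<theta>. 0 < r0 \<Longrightarrow> r0 < r1 \<Longrightarrow>
      log_gradient {r0..r1} {t0..t1} u v ur u\<theta> vr v\<theta> \<Longrightarrow>
      integral (S r0 r1) (\<lambda>z. (u z)\<^sup>2 + (v z)\<^sup>2)
      + integral {t0..t1} (\<lambda>\<theta>. r0 * (u (r0, \<theta>) + mult.m \<theta> * v (r0, \<theta>))\<^sup>2 + r1 * (v (r1, \<theta>))\<^sup>2)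
      + integral {r0..r1} (\<lambda>r. (u (r, t1) + mult.m t1 * v (r, t1))\<^sup>2 + (u (r, t0))\<^sup>2)
    \<le> C * (integral (S r0 r1) (\<lambda>z. (A22 b (snd z) * mult.oper u v ur u\<theta> v\<theta> z)\<^sup>2)
      + integral {t0..t1} (\<lambda>\<theta>. r1 * (u (r1, \<theta>) + mult.m \<theta> * v (r1, \<theta>))\<^sup>2 + r0 * (v (r0, \<theta>))\<^sup>2)
      + integral {r0..r1} (\<lambda>r. (u (r, t0) + mult.m t0 * v (r, t0))\<^sup>2 + (u (r, t1))\<^sup>2))"
    using mult.energy_estimate by blast
  have "energy ob t0 t1 r0 r1 \<Psi> \<le> C * data_size t0 t1 r0 r1 F g0 g1 h0 h1"
    if r: "0 < r0" "r0 < r1" and sol: "bvp_solution b ob t0 t1 r0 r1 F g0 g1 h0 h1 \<Psi>"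
    for r0 r1 F g0 g1 h0 h1 \<Psi>
  proof -
    obtain ur u\<theta> vr v\<theta> where sys: "system r0 r1 (\<lambda>z. fst z * pd (S r0 r1) (1, 0) \<Psi> z)
        (pd (S r0 r1) (0, 1) \<Psi>) ur u\<theta> vr v\<theta> F g0 g1 h0 h1"
      using bvp_solution_system[OF r sol] by blast
    then have grad: "log_gradient {r0..r1} {t0..t1} (\<lambda>z. fst z * pd (S r0 r1) (1, 0) \<Psi> z)
        (pd (S r0 r1) (0, 1) \<Psi>) ur u\<theta> vr v\<theta>"
      unfolding system_def by blast
    show ?thesis
      unfolding energy_eq[OF r] data_size_eq[OF sys, symmetric] by (rule est[OF r grad])
  qed
  then show ?thesis using C by blast
qed

text \<open>The difference of two solutions has zero data, so the estimate makes its gradient vanish almost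
  everywhere, hence everywhere by continuity.\<close>

theorem bvp_unique:
  assumes r: "0 < r0" "r0 < r1"
    and sol: "bvp_solution b ob t0 t1 r0 r1 F g0 g1 h0 h1 \<Psi>" "bvp_solution b ob t0 t1 r0 r1 F g0 g1 h0 h1 \<Phi>"
  shows "\<exists>c. \<forall>z\<in>S r0 r1. \<Phi> z = \<Psi> z + c"
proof -
  let ?P = "pd (S r0 r1) (1, 0)" and ?Q = "pd (S r0 r1) (0, 1)"
  define u v where "u z = fst z * ?P \<Phi> z - fst z * ?P \<Psi> z" and "v z = ?Q \<Phi> z - ?Q \<Psi> z" for z
  have "\<exists>ur u\<theta> vr v\<theta>. system r0 r1 u v ur u\<theta> vr v\<theta> (\<lambda>_ _. 0) (\<lambda>_. 0) (\<lambda>_. 0) (\<lambda>_. 0) (\<lambda>_. 0)"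
  proof -
    obtain ur u\<theta> vr v\<theta> where \<Phi>: "system r0 r1 (\<lambda>z. fst z * ?P \<Phi> z) (?Q \<Phi>) ur u\<theta> vr v\<theta> F g0 g1 h0 h1"
      using bvp_solution_system[OF r sol(2)] by blast
    obtain xr x\<theta> yr y\<theta> where \<Psi>: "system r0 r1 (\<lambda>z. fst z * ?P \<Psi> z) (?Q \<Psi>) xr x\<theta> yr y\<theta> F g0 g1 h0 h1"
      using bvp_solution_system[OF r sol(1)] by blast
    from system_diff[OF \<Phi> \<Psi>] show ?thesis unfolding u_def[abs_def] v_def[abs_def] by blast
  qed
  then obtain ur u\<theta> vr v\<theta>
    where sys: "system r0 r1 u v ur u\<theta> vr v\<theta> (\<lambda>_ _. 0) (\<lambda>_. 0) (\<lambda>_. 0) (\<lambda>_. 0) (\<lambda>_. 0)" by blast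
  then have grad: "log_gradient {r0..r1} {t0..t1} u v ur u\<theta> vr v\<theta>" by (simp add: system_def)
  have cont: "continuous_on (S r0 r1) u" "continuous_on (S r0 r1) v"
    using grad by (simp_all add: log_gradient_def)
  have slanted: "continuous_on (S r0 r1) (\<lambda>z. u z + mult.m (snd z) * v z)"
    by (intro continuous_intros cont mult.snd_cont mult.m_cont)
  have ends: "r0 \<in> {r0..r1}" "r1 \<in> {r0..r1}" "t0 \<in> {t0..t1}" "t1 \<in> {t0..t1}" using r t by auto
  have zero: "data_size t0 t1 r0 r1 (\<lambda>_ _. 0) (\<lambda>_. 0) (\<lambda>_. 0) (\<lambda>_. 0) (\<lambda>_. 0) = 0"
    by (simp add: data_size_def case_prod_beta')
  obtain C where "integral (S r0 r1) (\<lambda>z. (u z)\<^sup>2 + (v z)\<^sup>2)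
      + integral {t0..t1} (\<lambda>\<theta>. r0 * (u (r0, \<theta>) + mult.m \<theta> * v (r0, \<theta>))\<^sup>2 + r1 * (v (r1, \<theta>))\<^sup>2)
      + integral {r0..r1} (\<lambda>r. (u (r, t1) + mult.m t1 * v (r, t1))\<^sup>2 + (u (r, t0))\<^sup>2)
    \<le> C * data_size t0 t1 r0 r1 (\<lambda>_ _. 0) (\<lambda>_. 0) (\<lambda>_. 0) (\<lambda>_. 0) (\<lambda>_. 0)"
    using mult.energy_estimate r grad unfolding data_size_eq[OF sys, symmetric] by blast
  moreover have "0 \<le> integral {t0..t1} (\<lambda>\<theta>. r0 * (u (r0, \<theta>) + mult.m \<theta> * v (r0, \<theta>))\<^sup>2 + r1 * (v (r1, \<theta>))\<^sup>2)"
    using r by (intro integral_nonneg integrable_continuous_real continuous_intros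
      continuous_on_section(2)[OF slanted, unfolded snd_conv] continuous_on_section(2)[OF cont(2)] ends) auto
  moreover have "0 \<le> integral {r0..r1} (\<lambda>r. (u (r, t1) + mult.m t1 * v (r, t1))\<^sup>2 + (u (r, t0))\<^sup>2)"
    using r by (intro integral_nonneg integrable_continuous_real continuous_intros
      continuous_on_section(1)[OF cont(1)] continuous_on_section(1)[OF cont(2)] ends) auto
  moreover have "0 \<le> integral (S r0 r1) (\<lambda>z. (u z)\<^sup>2 + (v z)\<^sup>2)"
    by (intro integral_nonneg integrable_continuous[of "(r0, t0)" "(r1, t1)", unfolded cbox_rectangle]
      continuous_intros cont) auto
  ultimately have "integral (S r0 r1) (\<lambda>z. (u z)\<^sup>2 + (v z)\<^sup>2) = 0" unfolding zero by linarith
  moreover have "box (r0, t0) (r1, t1) \<noteq> {}"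
    using r t by (auto simp: box_rectangle)
  moreover have "continuous_on (S r0 r1) (\<lambda>z. (u z)\<^sup>2 + (v z)\<^sup>2)" by (intro continuous_intros cont)
  ultimately have "\<forall>z\<in>S r0 r1. (u z)\<^sup>2 + (v z)\<^sup>2 = 0"
    using integral_cbox_eq_0_iff[of "(r0, t0)" "(r1, t1)" "\<lambda>z. (u z)\<^sup>2 + (v z)\<^sup>2"]
    by (simp add: cbox_rectangle)
  then have uv: "?P \<Phi> z = ?P \<Psi> z" "?Q \<Phi> z = ?Q \<Psi> z" if "z \<in> S r0 r1" for z
    using that r by (auto simp: u_def v_def sum_power2_eq_zero_iff)
  have diff: "\<Psi> differentiable_on S r0 r1" "\<Phi> differentiable_on S r0 r1"
    using sol by (simp_all add: bvp_solution_def Let_def smooth_upto_differentiable)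
  have "\<exists>c. \<forall>x\<in>{r0..r1}. \<Phi> (x, y) - \<Psi> (x, y) = c" if y: "y \<in> {t0..t1}" for y
  proof (rule has_field_derivative_zero_constant)
    fix x assume x: "x \<in> {r0..r1}"
    show "((\<lambda>x. \<Phi> (x, y) - \<Psi> (x, y)) has_real_derivative 0) (at x within {r0..r1})"
      using DERIV_diff[OF pd_fst[OF diff(2) x y] pd_fst[OF diff(1) x y]] uv x y by simp
  qed simp
  moreover have "\<exists>c. \<forall>y\<in>{t0..t1}. \<Phi> (r0, y) - \<Psi> (r0, y) = c"
  proof (rule has_field_derivative_zero_constant)
    fix y assume y: "y \<in> {t0..t1}"
    show "((\<lambda>y. \<Phi> (r0, y) - \<Psi> (r0, y)) has_real_derivative 0) (at y within {t0..t1})"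
      using DERIV_diff[OF pd_snd[OF diff(2) ends(1) y] pd_snd[OF diff(1) ends(1) y]] uv ends(1) y by simp
  qed simp
  ultimately obtain c where "\<And>x y. x \<in> {r0..r1} \<Longrightarrow> y \<in> {t0..t1} \<Longrightarrow> \<Phi> (x, y) - \<Psi> (x, y) = c"
    using ends(1) by metis
  then have "\<forall>z\<in>S r0 r1. \<Phi> z = \<Psi> z + c" by force
  then show ?thesis by blast
qed

end

theorem theorem3p5:
  fixes b :: flow and thc \<delta>1 \<delta>2 \<sigma>0 :: real
  assumes "background_flow b"
    and "thc \<in> {th_m b..th_p b}"
    and "d_admissible b \<delta>1 \<delta>2"
    and "\<sigma>0 > 0" and "th_so b - \<sigma>0 \<ge> th_m b"
    and "\<forall>\<theta>\<in>{th_so b - \<sigma>0..th_p b}. K4 b thc \<delta>1 \<delta>2 \<theta> > 0"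
  shows "(\<exists>C>0. \<forall>r0 r1 F g0 g1 h0 h1 \<Psi>.
      0 < r0 \<and> r0 < r1 \<and>
      bvp_solution b (obl b thc \<delta>1 \<delta>2) (th_so b - \<sigma>0) (th_p b) r0 r1 F g0 g1 h0 h1 \<Psi> \<longrightarrow>
      energy (obl b thc \<delta>1 \<delta>2) (th_so b - \<sigma>0) (th_p b) r0 r1 \<Psi>
        \<le> C * data_size (th_so b - \<sigma>0) (th_p b) r0 r1 F g0 g1 h0 h1) \<and>
    (\<forall>r0 r1 F g0 g1 h0 h1 \<Psi> \<Phi>.
      0 < r0 \<and> r0 < r1 \<and>
      bvp_solution b (obl b thc \<delta>1 \<delta>2) (th_so b - \<sigma>0) (th_p b) r0 r1 F g0 g1 h0 h1 \<Psi> \<and>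
      bvp_solution b (obl b thc \<delta>1 \<delta>2) (th_so b - \<sigma>0) (th_p b) r0 r1 F g0 g1 h0 h1 \<Phi> \<longrightarrow>
      (\<exists>c. \<forall>z\<in>{r0..r1} \<times> {th_so b - \<sigma>0..th_p b}. \<Phi> z = \<Psi> z + c))"
proof -
  interpret conical_flow b by unfold_locales (rule assms)
  interpret bvp_setting b thc \<delta>1 \<delta>2 "th_so b - \<sigma>0" "th_p b"
    by unfold_locales (use assms th in auto)
  show ?thesis
    by (rule conjI[OF bvp_energy_estimate]) (intro allI impI, elim conjE, rule bvp_unique)
qed

end
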